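(* Let $n$ be a non-zero integer. Let $D_{2,n}(N)$, $D_{3,n}(N)$ be the numbers of $D(n)$-pairs, respectively $D(n)$-triples, with all elements in $\{1,2,\dots,N\}$, and let $D_{3,n}^{\mathrm{reg}}(N)$ be the number of regular $D(n)$-triples $\{a,b,c\}$ with $a<b<c\le N$. Then, as $N\to\infty$, \[ D_{3,n}(N)\sim D_{3,n}^{\mathrm{reg}}(N)\sim\frac{D_{2,n}(N)}{2}. \]
   Context: For a non-zero integer $n$, a $D(n)$-pair (resp. $D(n)$-triple) is a set of two (resp. three) distinct positive integers such that the product of any two of them plus $n$ is a perfect square. A $D(n)$-triple $\{a,b,c\}$ with $a<b<c$ is regular if $c=a+b+2r$, where $r\ge0$ and $r^2=ab+n$; otherwise it is irregular. *)

theory Defs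
  imports Complex_Main
    "HOL-Library.Landau_Symbols"
    "HOL-Computational_Algebra.Nth_Powers"
begin

(* The elements are integers rather than naturals because n may be negative,
   so that x * y + n must not be truncated.  The value 0 counts as a square. *)
definition is_D_tuple :: "int \<Rightarrow> nat \<Rightarrow> int set \<Rightarrow> bool" where
  "is_D_tuple n m A \<longleftrightarrow>
     finite A \<and> card A = m \<and> (\<forall>x\<in>A. x > 0) \<and>
     (\<forall>x\<in>A. \<forall>y\<in>A. x \<noteq> y \<longrightarrow> is_square (x * y + n))"

definition is_regular_D_triple :: "int \<Rightarrow> int set \<Rightarrow> bool" where
  "is_regular_D_triple n A \<longleftrightarrow>
     is_D_tuple n 3 A \<and>
     (\<exists>a b c r. A = {a, b, c} \<and> a < b \<and> b < c \<and>
        r \<ge> 0 \<and> r ^ 2 = a * b + n \<and> c = a + b + 2 * r)"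

definition D2_count :: "int \<Rightarrow> nat \<Rightarrow> nat" where
  "D2_count n N = card {A. is_D_tuple n 2 A \<and> A \<subseteq> {1..int N}}"

definition D3_count :: "int \<Rightarrow> nat \<Rightarrow> nat" where
  "D3_count n N = card {A. is_D_tuple n 3 A \<and> A \<subseteq> {1..int N}}"

definition D3_reg_count :: "int \<Rightarrow> nat \<Rightarrow> nat" where
  "D3_reg_count n N = card {A. is_regular_D_triple n A \<and> A \<subseteq> {1..int N}}"

end

(*
  A pair x < c with x * c + n = s^2 has the companion y = x + c - 2s, which apart from few
  exceptions satisfies 0 < y < c and turns {x, y, c} into a regular triple with largest element c.
  Conversely a regular triple a < b < c arises in this way from exactly the two pairs (a, c) and
  (b, c). Hence D_2 = 2 D_3^reg + (number of exceptional pairs). The exceptional pairs are finite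
  in number if n is not a square, and O(N) if n is a square.

  For an irregular triple with roots r, s, t of ab+n, ac+n, bc+n, the integer
  e = n(a+b+c) + 2abc - 2rst satisfies ce + n^2 = (cr-st)^2, so e >= 1 once c > n^2, and
  e <= n^2 c / (ab). As c is a root of a quadratic determined by a, b, e, a pair (a, b) has
  O(N/(ab)) irregular extensions with c <= N, and for fixed (a, b) only O(sqrt N). The sum of
  1/(ab) over all pairs converges by the divisor bound d(m) = O(m^(1/3)), so Tannery's theorem
  shows that there are o(N) irregular triples.

  It remains to see that D_2 is at least cN, and that D_2/N tends to infinity if n is a square.
  Pairs are produced from residues r mod x with x | r^2 - n. For the first claim take
  x = p^2 - n q^2 and qr = -p mod x with coprime p, q; for the second it suffices to treat n = 1,
  where x = de, r = 1 mod d and r = -1 mod e.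
*)

theory Submission
  imports
    Defs
    "HOL-Number_Theory.Totient"
    "HOL-Computational_Algebra.Polynomial"
    "HOL-Analysis.Uniform_Limit"
    "HOL-Analysis.Summation_Tests"
begin

section \<open>Pairs and regular triples\<close>

definition D_pairs :: "int \<Rightarrow> nat \<Rightarrow> (int \<times> int) set" where
  "D_pairs n N = {(x, y). 0 < x \<and> x < y \<and> y \<le> int N \<and> is_square (x * y + n)}"

definition D_triples :: "int \<Rightarrow> nat \<Rightarrow> (int \<times> int \<times> int) set" where
  "D_triples n N = {(a, b, c). 0 < a \<and> a < b \<and> b < c \<and> c \<le> int N \<and>
     is_square (a * b + n) \<and> is_square (a * c + n) \<and> is_square (b * c + n)}"

definition reg_triples :: "int \<Rightarrow> nat \<Rightarrow> (int \<times> int \<times> int) set" where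
  "reg_triples n N = {(a, b, c). 0 < a \<and> a < b \<and> b < c \<and> c \<le> int N \<and>
     (\<exists>r\<ge>0. r ^ 2 = a * b + n \<and> c = a + b + 2 * r)}"

lemma is_square_int_iff: "is_square (m :: int) \<longleftrightarrow> (\<exists>r\<ge>0. m = r ^ 2)"
  by (metis abs_ge_zero is_nth_power_def power2_abs)

lemma finite_D_pairs: "finite (D_pairs n N)"
  by (rule finite_subset[of _ "{0..int N} \<times> {0..int N}"]) (auto simp: D_pairs_def)

lemma finite_D_triples: "finite (D_triples n N)"
  by (rule finite_subset[of _ "{0..int N} \<times> {0..int N} \<times> {0..int N}"]) (auto simp: D_triples_def)

text \<open>Indeed \<open>a * c + n = a ^ 2 + 2 * a * r + (a * b + n)\<close>, and likewise for
  \<open>b\<close>. So a regular triple is a D(n)-triple, and \<open>r\<close> can be read off from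
  the root of either pair containing \<open>c\<close>.\<close>

lemma reg_triple_squares:
  fixes a b c r n :: int
  assumes "r ^ 2 = a * b + n" "c = a + b + 2 * r"
  shows "a * c + n = (a + r) ^ 2" "b * c + n = (b + r) ^ 2"
  using assms by (simp_all add: power2_eq_square algebra_simps)

lemma reg_triples_subset: "reg_triples n N \<subseteq> D_triples n N"
proof
  fix p assume "p \<in> reg_triples n N"
  then obtain a b c r where p: "p = (a, b, c)" "0 < a" "a < b" "b < c" "c \<le> int N"
    and r: "r ^ 2 = a * b + n" "c = a + b + 2 * r" by (auto simp: reg_triples_def)
  show "p \<in> D_triples n N"
    using p reg_triple_squares[OF r] by (simp add: D_triples_def flip: r(1))
qed

lemma finite_reg_triples: "finite (reg_triples n N)"
  by (rule finite_subset[OF reg_triples_subset finite_D_triples])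

lemma D2_count_eq: "D2_count n N = card (D_pairs n N)"
proof -
  have "bij_betw (\<lambda>(x, y). {x, y}) (D_pairs n N) {A. is_D_tuple n 2 A \<and> A \<subseteq> {1..int N}}"
  proof (rule bij_betw_imageI)
    show "inj_on (\<lambda>(x, y). {x, y}) (D_pairs n N)"
      by (auto simp: inj_on_def D_pairs_def doubleton_eq_iff)
    show "(\<lambda>(x, y). {x, y}) ` D_pairs n N = {A. is_D_tuple n 2 A \<and> A \<subseteq> {1..int N}}"
    proof (intro equalityI subsetI)
      fix A assume "A \<in> (\<lambda>(x, y). {x, y}) ` D_pairs n N"
      then show "A \<in> {A. is_D_tuple n 2 A \<and> A \<subseteq> {1..int N}}"
        by (auto simp: D_pairs_def is_D_tuple_def mult.commute)
    next
      fix A assume "A \<in> {A. is_D_tuple n 2 A \<and> A \<subseteq> {1..int N}}"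
      then have A: "is_D_tuple n 2 A" "A \<subseteq> {1..int N}" by auto
      then obtain x y where xy: "A = {x, y}" "x \<noteq> y"
        unfolding is_D_tuple_def card_2_iff by blast
      have "(min x y, max x y) \<in> D_pairs n N"
        using A xy by (auto simp: D_pairs_def is_D_tuple_def min_def max_def)
      moreover have "A = {min x y, max x y}"
        using xy by (auto simp: min_def max_def)
      ultimately show "A \<in> (\<lambda>(x, y). {x, y}) ` D_pairs n N" by force
    qed
  qed
  then show ?thesis unfolding D2_count_def by (simp add: bij_betw_same_card)
qed

lemma ex_sorted_triple:
  fixes A :: "'a :: linorder set"
  assumes "card A = 3"
  obtains a b c where "A = {a, b, c}" "a < b" "b < c"
proof -
  have "finite A" using assms by (metis card.infinite zero_neq_numeral)
  then have "length (sorted_list_of_set A) = Suc (Suc (Suc 0))" using assms by simp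
  then obtain a b c where abc: "sorted_list_of_set A = [a, b, c]"
    unfolding length_Suc_conv length_0_conv by blast
  then have "A = {a, b, c}" using set_sorted_list_of_set[OF \<open>finite A\<close>] by simp
  moreover have "a < b" "b < c"
    using strict_sorted_list_of_set[of A] by (auto simp: abc)
  ultimately show ?thesis using that by blast
qed

lemma sorted_triple_eq_iff:
  fixes a b c :: "'a :: linorder"
  assumes "a < b" "b < c" "a' < b'" "b' < c'"
  shows "{a, b, c} = {a', b', c'} \<longleftrightarrow> a = a' \<and> b = b' \<and> c = c'"
proof
  assume "{a, b, c} = {a', b', c'}"
  then have "[a, b, c] = [a', b', c']"
    using assms by (intro sorted_distinct_set_unique) (auto dest: less_trans)
  then show "a = a' \<and> b = b' \<and> c = c'" by simp
qed auto

lemma D_tuple_3_iff: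
  assumes "a < b" "b < c"
  shows "is_D_tuple n 3 {a, b, c} \<and> {a, b, c} \<subseteq> {1..int N} \<longleftrightarrow> (a, b, c) \<in> D_triples n N"
  using assms by (auto simp: is_D_tuple_def D_triples_def mult.commute)

lemma D3_count_eq: "D3_count n N = card (D_triples n N)"
proof -
  have "bij_betw (\<lambda>(a, b, c). {a, b, c}) (D_triples n N) {A. is_D_tuple n 3 A \<and> A \<subseteq> {1..int N}}"
  proof (rule bij_betw_imageI)
    show "inj_on (\<lambda>(a, b, c). {a, b, c}) (D_triples n N)"
      by (auto simp: inj_on_def D_triples_def sorted_triple_eq_iff)
    show "(\<lambda>(a, b, c). {a, b, c}) ` D_triples n N = {A. is_D_tuple n 3 A \<and> A \<subseteq> {1..int N}}"
    proof (intro equalityI subsetI)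
      fix A assume "A \<in> (\<lambda>(a, b, c). {a, b, c}) ` D_triples n N"
      then obtain a b c where "(a, b, c) \<in> D_triples n N" "A = {a, b, c}" by auto
      moreover from this have "a < b" "b < c" by (auto simp: D_triples_def)
      ultimately show "A \<in> {A. is_D_tuple n 3 A \<and> A \<subseteq> {1..int N}}"
        using D_tuple_3_iff by blast
    next
      fix A assume A: "A \<in> {A. is_D_tuple n 3 A \<and> A \<subseteq> {1..int N}}"
      then obtain a b c where "A = {a, b, c}" "a < b" "b < c"
        using ex_sorted_triple[of A] by (auto simp: is_D_tuple_def)
      with A have "(a, b, c) \<in> D_triples n N" using D_tuple_3_iff by blast
      with \<open>A = _\<close> show "A \<in> (\<lambda>(a, b, c). {a, b, c}) ` D_triples n N" by force
    qed
  qed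
  then show ?thesis unfolding D3_count_def by (simp add: bij_betw_same_card)
qed

lemma D3_reg_count_eq: "D3_reg_count n N = card (reg_triples n N)"
proof -
  have "bij_betw (\<lambda>(a, b, c). {a, b, c}) (reg_triples n N) {A. is_regular_D_triple n A \<and> A \<subseteq> {1..int N}}"
  proof (rule bij_betw_imageI)
    show "inj_on (\<lambda>(a, b, c). {a, b, c}) (reg_triples n N)"
      by (auto simp: inj_on_def reg_triples_def sorted_triple_eq_iff)
    show "(\<lambda>(a, b, c). {a, b, c}) ` reg_triples n N = {A. is_regular_D_triple n A \<and> A \<subseteq> {1..int N}}"
    proof (intro equalityI subsetI)
      fix A assume "A \<in> (\<lambda>(a, b, c). {a, b, c}) ` reg_triples n N"
      then obtain a b c where abc: "(a, b, c) \<in> reg_triples n N" "A = {a, b, c}" by auto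
      moreover from this have less: "a < b" "b < c" by (auto simp: reg_triples_def)
      moreover have "(a, b, c) \<in> D_triples n N" using abc reg_triples_subset by blast
      ultimately show "A \<in> {A. is_regular_D_triple n A \<and> A \<subseteq> {1..int N}}"
        using D_tuple_3_iff[OF less, of n N] unfolding is_regular_D_triple_def reg_triples_def by blast
    next
      fix A assume A: "A \<in> {A. is_regular_D_triple n A \<and> A \<subseteq> {1..int N}}"
      then have "\<exists>a b c r. A = {a, b, c} \<and> a < b \<and> b < c \<and> r \<ge> 0 \<and> r ^ 2 = a * b + n \<and> c = a + b + 2 * r"
        by (simp only: is_regular_D_triple_def mem_Collect_eq)
      then obtain a b c r where abc: "A = {a, b, c}" "a < b" "b < c" "r \<ge> 0" "r ^ 2 = a * b + n"
        "c = a + b + 2 * r" by (elim exE conjE)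
      have "(a, b, c) \<in> D_triples n N"
        using A D_tuple_3_iff[OF abc(2,3), of n N] unfolding is_regular_D_triple_def abc(1) by simp
      then have "(a, b, c) \<in> reg_triples n N"
        using abc(4-6) unfolding D_triples_def reg_triples_def by blast
      with abc show "A \<in> (\<lambda>(a, b, c). {a, b, c}) ` reg_triples n N" by force
    qed
  qed
  then show ?thesis unfolding D3_reg_count_def by (simp add: bij_betw_same_card)
qed

section \<open>Exceptional pairs\<close>

definition bad_pairs :: "int \<Rightarrow> nat \<Rightarrow> (int \<times> int) set" where
  "bad_pairs n N = D_pairs n N -
     ((\<lambda>(a, b, c). (a, c)) ` reg_triples n N \<union> (\<lambda>(a, b, c). (b, c)) ` reg_triples n N)"

text \<open>A pair \<open>(x, c)\<close> coming from a regular triple has root \<open>x + r\<close>,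
  so it determines \<open>r\<close> and then the third element \<open>c - x - 2 * r\<close>. Hence
  both projections are injective. A common value would give \<open>b = a'\<close> with
  \<open>a' < a < b\<close>, so the images are disjoint.\<close>

lemma card_D_pairs: "card (D_pairs n N) = 2 * card (reg_triples n N) + card (bad_pairs n N)"
proof -
  let ?f = "\<lambda>(a :: int, b :: int, c :: int). (a, c)"
  let ?g = "\<lambda>(a :: int, b :: int, c :: int). (b, c)"
  let ?R = "reg_triples n N"
  have inj_f: "inj_on ?f ?R"
  proof -
    have "b = b'" if "(a, b, c) \<in> ?R" "(a, b', c) \<in> ?R" for a b b' c
    proof -
      obtain r r' where r: "r \<ge> 0" "r ^ 2 = a * b + n" "c = a + b + 2 * r"
        "r' \<ge> 0" "r' ^ 2 = a * b' + n" "c = a + b' + 2 * r'" "a > 0"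
        using \<open>(a, b, c) \<in> ?R\<close> \<open>(a, b', c) \<in> ?R\<close> by (auto simp: reg_triples_def)
      have "(a + r) ^ 2 = (a + r') ^ 2"
        using reg_triple_squares(1)[OF r(2,3)] reg_triple_squares(1)[OF r(5,6)] by simp
      then have "a + r = a + r'" using r by (subst (asm) power2_eq_iff_nonneg) auto
      then show ?thesis using r by linarith
    qed
    then show ?thesis by (auto simp: inj_on_def)
  qed
  have inj_g: "inj_on ?g ?R"
  proof -
    have "a = a'" if "(a, b, c) \<in> ?R" "(a', b, c) \<in> ?R" for a a' b c
    proof -
      obtain r r' where r: "r \<ge> 0" "r ^ 2 = a * b + n" "c = a + b + 2 * r"
        "r' \<ge> 0" "r' ^ 2 = a' * b + n" "c = a' + b + 2 * r'" "b > 0"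
        using \<open>(a, b, c) \<in> ?R\<close> \<open>(a', b, c) \<in> ?R\<close> by (fastforce simp: reg_triples_def)
      have "(b + r) ^ 2 = (b + r') ^ 2"
        using reg_triple_squares(2)[OF r(2,3)] reg_triple_squares(2)[OF r(5,6)] by simp
      then have "b + r = b + r'" using r by (subst (asm) power2_eq_iff_nonneg) auto
      then show ?thesis using r by linarith
    qed
    then show ?thesis by (auto simp: inj_on_def)
  qed
  have disj: "?f ` ?R \<inter> ?g ` ?R = {}"
  proof -
    have False if "(a, b, c) \<in> ?R" "(a', a, c) \<in> ?R" for a a' b c
    proof -
      obtain r r' where r: "r \<ge> 0" "r ^ 2 = a * b + n" "c = a + b + 2 * r"
        "r' \<ge> 0" "r' ^ 2 = a' * a + n" "c = a' + a + 2 * r'" "a > 0" "a < b" "a' < a"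
        using \<open>(a, b, c) \<in> ?R\<close> \<open>(a', a, c) \<in> ?R\<close> by (fastforce simp: reg_triples_def)
      have "(a + r) ^ 2 = (a + r') ^ 2"
        using reg_triple_squares(1)[OF r(2,3)] reg_triple_squares(2)[OF r(5,6)] by simp
      then have "a + r = a + r'" using r by (subst (asm) power2_eq_iff_nonneg) auto
      then show ?thesis using r by linarith
    qed
    then show ?thesis by auto
  qed
  have sub: "?f ` ?R \<union> ?g ` ?R \<subseteq> D_pairs n N"
    using reg_triples_subset[of n N] by (auto simp: D_pairs_def D_triples_def)
  have fin: "finite (?f ` ?R)" "finite (?g ` ?R)" by (auto simp: finite_reg_triples)
  have "card (?f ` ?R \<union> ?g ` ?R) = 2 * card ?R"
    using disj fin inj_f inj_g by (simp add: card_Un_disjoint card_image)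
  moreover have "card (bad_pairs n N) = card (D_pairs n N) - card (?f ` ?R \<union> ?g ` ?R)"
    unfolding bad_pairs_def using sub fin by (intro card_Diff_subset) auto
  moreover have "card (?f ` ?R \<union> ?g ` ?R) \<le> card (D_pairs n N)"
    using sub by (intro card_mono finite_D_pairs)
  ultimately show ?thesis by simp
qed

text \<open>The companion \<open>y = x + c - 2 * s\<close> completes the pair to a regular triple
  once \<open>0 < y < c\<close>, \<open>y \<noteq> x\<close> and \<open>s \<ge> x\<close>. Since
  \<open>s ^ 2 = x * c + n\<close>, the failure \<open>y \<le> 0\<close> amounts to
  \<open>(c - x) ^ 2 \<le> 4 * n\<close>; every other failure bounds \<open>c\<close>.\<close>

lemma bad_pairs_cases:
  assumes "n \<noteq> 0" "(x, c) \<in> bad_pairs n N"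
  shows "(c - x) ^ 2 \<le> 4 * n \<or> c \<le> 4 * \<bar>n\<bar>"
proof (rule ccontr)
  assume "\<not> ?thesis"
  then have ge: "(c - x) ^ 2 > 4 * n" "c > 4 * \<bar>n\<bar>" by auto
  have pair: "0 < x" "x < c" "c \<le> int N" and "is_square (x * c + n)"
    using assms by (auto simp: bad_pairs_def D_pairs_def)
  then obtain s where s: "s \<ge> 0" "x * c + n = s ^ 2" by (auto simp: is_square_int_iff)
  define y where "y = x + c - 2 * s"
  have "s \<ge> x"
  proof (rule ccontr)
    assume "\<not> s \<ge> x"
    then have "s ^ 2 < x ^ 2" using s by (intro power_strict_mono) auto
    then have "x * (c - x) < \<bar>n\<bar>" using s by (auto simp: power2_eq_square algebra_simps)
    \<comment> \<open>Expanded, this says \<open>x * (c - x) \<ge> c - 1\<close>, so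
      \<open>c \<le> \<bar>n\<bar>\<close>.\<close>
    moreover have "(x - 1) * (c - x - 1) \<ge> 0" using pair by simp
    ultimately show False using ge pair by (simp add: algebra_simps)
  qed
  have "y > 0"
  proof (rule ccontr)
    assume "\<not> y > 0"
    then have "(x + c) ^ 2 \<le> (2 * s) ^ 2" using pair by (intro power_mono) (auto simp: y_def)
    then show False using s ge by (simp add: power2_eq_square algebra_simps)
  qed
  have "y \<noteq> x"
  proof
    assume "y = x"
    then have "c = 2 * s" by (simp add: y_def)
    then have "c * (c - 4 * x) = 4 * n" using s by (simp add: power2_eq_square algebra_simps)
    then have "c dvd 4 * n" by (metis dvd_triv_left)
    then have "\<bar>c\<bar> \<le> \<bar>4 * n\<bar>" using \<open>n \<noteq> 0\<close> by (intro dvd_imp_le_int) auto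
    then show False using ge pair by simp
  qed
  have "y < c"
  proof (rule ccontr)
    assume "\<not> y < c"
    then have "(2 * s) ^ 2 \<le> x ^ 2" using s by (intro power_mono) (auto simp: y_def)
    then have "4 * (x * c) + 4 * n \<le> x * x" using s by (simp add: power2_eq_square algebra_simps)
    moreover have "x * x \<le> x * c" using pair by simp
    moreover have "1 * c \<le> x * c" using pair by (intro mult_right_mono) auto
    ultimately show False using ge pair by linarith
  qed
  \<comment> \<open>The root of \<open>x * y + n\<close> is \<open>s - x\<close>, whence the need
    for \<open>s \<ge> x\<close>.\<close>
  have c: "c = x + y + 2 * (s - x)" and yx: "(s - x) ^ 2 = x * y + n"
    using s by (auto simp: y_def power2_eq_square algebra_simps)
  show False
  proof (cases "x < y")
    case True
    then have "(x, y, c) \<in> reg_triples n N"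
      using pair c yx \<open>s \<ge> x\<close> \<open>y < c\<close> by (auto simp: reg_triples_def intro!: exI[of _ "s - x"])
    then show False using assms by (force simp: bad_pairs_def)
  next
    case False
    then have "(y, x, c) \<in> reg_triples n N"
      using pair c yx \<open>s \<ge> x\<close> \<open>y \<noteq> x\<close> \<open>y > 0\<close>
      by (auto simp: reg_triples_def mult.commute intro!: exI[of _ "s - x"])
    then show False using assms by (force simp: bad_pairs_def)
  qed
qed

text \<open>Outside a fixed box, \<open>(c - x) ^ 2 \<le> 4 * n\<close> bounds the difference
  \<open>d = c - x\<close>, and the pair is determined by \<open>d\<close> and
  \<open>c\<close>.\<close>

lemma card_bad_pairs_le:
  assumes "n \<noteq> 0"
  shows "card (bad_pairs n N) \<le> nat (4 * \<bar>n\<bar>) ^ 2 + nat (2 * \<bar>n\<bar>) * N"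
proof -
  let ?S = "{1..4 * \<bar>n\<bar>} \<times> {1..4 * \<bar>n\<bar>}"
  let ?T = "(\<lambda>(d, c). (c - d, c)) ` ({1..2 * \<bar>n\<bar>} \<times> {1..int N})"
  have "bad_pairs n N \<subseteq> ?S \<union> ?T"
  proof
    fix p assume p: "p \<in> bad_pairs n N"
    obtain x c where xc: "p = (x, c)" by force
    have pair: "0 < x" "x < c" "c \<le> int N" using p xc by (auto simp: bad_pairs_def D_pairs_def)
    show "p \<in> ?S \<union> ?T"
    proof (cases "c \<le> 4 * \<bar>n\<bar>")
      case False
      then have "(c - x) ^ 2 \<le> 4 * n" using bad_pairs_cases assms p xc by blast
      also have "\<dots> \<le> (2 * \<bar>n\<bar>) ^ 2"
      proof -
        have "\<bar>n\<bar> \<ge> 1" using assms by linarith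
        from self_le_power[OF this, of 2] show ?thesis by (simp add: power_mult_distrib)
      qed
      finally have "c - x \<le> 2 * \<bar>n\<bar>" by (rule power2_le_imp_le) simp
      then have "p \<in> ?T" using pair xc by (auto intro!: image_eqI[of _ _ "(c - x, c)"])
      then show ?thesis by blast
    qed (use pair xc in auto)
  qed
  then have "card (bad_pairs n N) \<le> card (?S \<union> ?T)" by (intro card_mono) auto
  also have "\<dots> \<le> card ?S + card ?T" by (rule card_Un_le)
  also have "card ?T \<le> card ({1..2 * \<bar>n\<bar>} \<times> {1..int N})" by (intro card_image_le) auto
  finally show ?thesis by (simp add: card_cartesian_product power2_eq_square)
qed

text \<open>The number \<open>(c - x) ^ 2 - 4 * n\<close> factors as
  \<open>u * (x + c + 2 * s)\<close> with \<open>u = x + c - 2 * s\<close>, and \<open>u = 0\<close>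
  would make \<open>n\<close> a square. So if \<open>(c - x) ^ 2 \<le> 4 * n\<close>, the second
  factor is at most \<open>4 * \<bar>n\<bar>\<close>, a bound independent of
  \<open>N\<close>.\<close>

lemma card_bad_pairs_le_nonsquare:
  assumes "n \<noteq> 0" "\<not> is_square n"
  shows "card (bad_pairs n N) \<le> nat (4 * \<bar>n\<bar>) ^ 2"
proof -
  let ?S = "{1..4 * \<bar>n\<bar>} \<times> {1..4 * \<bar>n\<bar>}"
  have "bad_pairs n N \<subseteq> ?S"
  proof
    fix p assume p: "p \<in> bad_pairs n N"
    obtain x c where xc: "p = (x, c)" by force
    have pair: "0 < x" "x < c" "c \<le> int N" "is_square (x * c + n)"
      using p xc by (auto simp: bad_pairs_def D_pairs_def)
    have "c \<le> 4 * \<bar>n\<bar>"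
    proof (rule ccontr)
      assume *: "\<not> c \<le> 4 * \<bar>n\<bar>"
      then have le: "(c - x) ^ 2 \<le> 4 * n" using bad_pairs_cases assms p xc by blast
      obtain s where s: "s \<ge> 0" "x * c + n = s ^ 2" using pair by (auto simp: is_square_int_iff)
      define u where "u = x + c - 2 * s"
      have eq: "u * (x + c + 2 * s) = (c - x) ^ 2 - 4 * n"
        using s by (simp add: u_def power2_eq_square algebra_simps)
      have "u \<noteq> 0"
      proof
        assume "u = 0"
        then have eq4: "(c - x) ^ 2 = 4 * n" using eq by simp
        then have "even (c - x)" by (metis dvd_triv_left even_mult_iff even_numeral even_power)
        then obtain k where "c - x = 2 * k" by (elim evenE)
        then have "n = k ^ 2" using eq4 by simp
        then show False using assms by simp
      qed
      then have "1 * (x + c + 2 * s) \<le> \<bar>u\<bar> * (x + c + 2 * s)"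
        using pair s by (intro mult_right_mono) auto
      also have "\<dots> = \<bar>(c - x) ^ 2 - 4 * n\<bar>"
        using pair s by (simp flip: eq add: abs_mult)
      also have "\<dots> \<le> 4 * \<bar>n\<bar>" using le zero_le_power2[of "c - x"] by linarith
      finally have "x + c + 2 * s \<le> 4 * \<bar>n\<bar>" by simp
      then show False using * pair(1,2) s(1) by linarith
    qed
    then show "p \<in> ?S" using pair xc by auto
  qed
  then have "card (bad_pairs n N) \<le> card ?S" by (intro card_mono) auto
  then show ?thesis by (simp add: card_cartesian_product power2_eq_square)
qed

section \<open>Lower bounds for the number of pairs\<close>

lemma ex_cong_in_window:
  fixes x :: int
  assumes "x > 0"
  obtains r where "A \<le> r" "r < A + x" "x dvd r - r0"
proof
  let ?r = "A + (r0 - A) mod x"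
  show "A \<le> ?r" "?r < A + x" using assms by auto
  have "?r - r0 = - (x * ((r0 - A) div x))"
    using minus_mult_div_eq_mod[of "r0 - A" x] by (simp add: algebra_simps)
  then show "x dvd ?r - r0" by simp
qed

text \<open>Each \<open>(x, r)\<close> yields the pair \<open>(x, y)\<close> with
  \<open>x * y = r ^ 2 - n\<close>. The window for \<open>r\<close> has length \<open>x\<close>, so
  it meets every residue class once; its lower end forces \<open>y > x\<close> and its upper end
  bounds \<open>y\<close>. As \<open>r\<close> is positive, it can be recovered from
  \<open>x\<close> and \<open>y\<close>.\<close>

lemma card_D_pairs_ge:
  fixes n :: int
  assumes "n \<noteq> 0"
    and S: "\<And>x r. (x, r) \<in> S \<Longrightarrow> 0 < x \<and> x + \<bar>n\<bar> \<le> r \<and> r < 2 * x + \<bar>n\<bar> \<and> x dvd r ^ 2 - n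
               \<and> 4 * x + n ^ 2 + 5 * \<bar>n\<bar> \<le> int N"
  shows "card S \<le> card (D_pairs n N)"
proof (rule card_inj_on_le)
  let ?f = "\<lambda>(x, r). (x, (r ^ 2 - n) div x)"
  show "finite (D_pairs n N)" by (rule finite_D_pairs)
  show "inj_on ?f S"
  proof -
    have "r = r'" if *: "(x, r) \<in> S" "(x, r') \<in> S" "(r ^ 2 - n) div x = (r' ^ 2 - n) div x" for x r r'
    proof -
      from * have "r ^ 2 - n = r' ^ 2 - n"
        using S[OF *(1)] S[OF *(2)] by (metis dvd_div_mult_self)
      then have "r ^ 2 = r' ^ 2" by simp
      then show ?thesis using S[OF *(1)] S[OF *(2)] by (subst (asm) power2_eq_iff_nonneg) auto
    qed
    then show ?thesis by (auto simp: inj_on_def)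
  qed
  show "?f ` S \<subseteq> D_pairs n N"
  proof clarify
    fix x r assume xr: "(x, r) \<in> S"
    define y where "y = (r ^ 2 - n) div x"
    have x: "0 < x" "x + \<bar>n\<bar> \<le> r" "r < 2 * x + \<bar>n\<bar>" "4 * x + n ^ 2 + 5 * \<bar>n\<bar> \<le> int N"
      using S[OF xr] by auto
    have xy: "x * y = r ^ 2 - n" using S[OF xr] by (simp add: y_def)
    have "(x + \<bar>n\<bar>) ^ 2 \<le> r ^ 2" using x by (intro power_mono) auto
    moreover have "x * \<bar>n\<bar> \<ge> 1 * \<bar>n\<bar>" using x by (intro mult_right_mono) auto
    moreover have "n ^ 2 > 0" using assms by simp
    moreover have "(x + \<bar>n\<bar>) ^ 2 = x * x + 2 * (x * \<bar>n\<bar>) + n ^ 2"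
      by (simp add: power2_eq_square algebra_simps)
    ultimately have "x * y > x * x" unfolding xy by linarith
    then have "x < y" using x by simp
    have "r ^ 2 \<le> (2 * x + \<bar>n\<bar>) ^ 2" using x by (intro power_mono) auto
    \<comment> \<open>Since \<open>x \<ge> 1\<close>, the constant remainder may be multiplied by
      \<open>x\<close>, so that \<open>x\<close> cancels; this is the source of
      \<open>n ^ 2 + 5 * \<bar>n\<bar>\<close>.\<close>
    moreover have "x * (n ^ 2 + \<bar>n\<bar>) \<ge> 1 * (n ^ 2 + \<bar>n\<bar>)" using x by (intro mult_right_mono) auto
    moreover have "(2 * x + \<bar>n\<bar>) ^ 2 = 4 * (x * x) + 4 * (x * \<bar>n\<bar>) + n ^ 2"
      by (simp add: power2_eq_square algebra_simps)
    moreover have "- n \<le> \<bar>n\<bar>" by simp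
    ultimately have "x * y \<le> 4 * (x * x) + 4 * (x * \<bar>n\<bar>) + x * (n ^ 2 + \<bar>n\<bar>)"
      unfolding xy mult_1 by linarith
    also have "\<dots> = x * (4 * x + n ^ 2 + 5 * \<bar>n\<bar>)" by (simp add: algebra_simps)
    finally have "x * y \<le> x * (4 * x + n ^ 2 + 5 * \<bar>n\<bar>)" .
    then have "y \<le> 4 * x + n ^ 2 + 5 * \<bar>n\<bar>" using x by simp
    with x \<open>x < y\<close> xy show "(x, (r ^ 2 - n) div x) \<in> D_pairs n N"
      by (auto simp: D_pairs_def simp flip: y_def)
  qed
qed

section \<open>Coprime pairs and the norm form \<open>p ^ 2 - n * q ^ 2\<close>\<close>

lemma card_multiples_atMost:
  assumes "q > 0"
  shows "card {m \<in> {1..Q}. q dvd m} = Q div (q :: nat)"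
proof -
  have "{m \<in> {1..Q}. q dvd m} = (\<lambda>k. q * k) ` {1..Q div q}"
  proof (intro equalityI subsetI)
    fix m assume m: "m \<in> {m \<in> {1..Q}. q dvd m}"
    then obtain k where "m = q * k" by auto
    with m assms show "m \<in> (\<lambda>k. q * k) ` {1..Q div q}"
      by (auto simp: less_eq_div_iff_mult_less_eq mult.commute Suc_le_eq)
  qed (use assms in \<open>auto simp: less_eq_div_iff_mult_less_eq mult.commute Suc_le_eq\<close>)
  moreover have "inj_on (\<lambda>k. q * k) {1..Q div q}" using assms by (auto simp: inj_on_def)
  ultimately show ?thesis by (simp add: card_image)
qed

text \<open>Sum Gauss's identity, that the totients of the divisors of \<open>m\<close> add up to
  \<open>m\<close>, over \<open>m \<le> Q\<close> and swap: each \<open>q\<close> divides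
  \<open>Q div q\<close> of the \<open>m\<close>. This later counts coprime pairs exactly.\<close>

lemma sum_totient_mult_div: "(\<Sum>q = 1..Q. totient q * (Q div q)) = Q * (Q + 1) div 2"
proof -
  have "(\<Sum>m = 1..Q. m) = (\<Sum>m = 1..Q. \<Sum>q \<in> {q \<in> {1..Q}. q dvd m}. totient q)"
  proof (rule sum.cong[OF refl])
    fix m assume "m \<in> {1..Q}"
    then have "{q \<in> {1..Q}. q dvd m} = {q. q dvd m}"
      by (auto dest: dvd_imp_le intro: le_trans simp: Suc_le_eq dvd_pos_nat)
    then show "m = (\<Sum>q \<in> {q \<in> {1..Q}. q dvd m}. totient q)"
      by (simp add: totient_divisor_sum)
  qed
  also have "\<dots> = (\<Sum>q = 1..Q. \<Sum>m \<in> {m \<in> {1..Q}. q dvd m}. totient q)"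
    by (rule sum.swap_restrict) auto
  also have "\<dots> = (\<Sum>q = 1..Q. totient q * (Q div q))"
    by (intro sum.cong refl) (subst sum_constant, subst card_multiples_atMost, auto)
  finally show ?thesis using gauss_sum_from_Suc_0[of Q, where ?'a = nat] by simp
qed

lemma totative_blocks_eq_iff:
  assumes "q * t + j = q * t' + j'" "j \<in> totatives q" "j' \<in> totatives q"
  shows "t = t' \<and> j = j'"
proof -
  have j: "0 < j" "j \<le> q" "0 < j'" "j' \<le> q" using assms by (auto simp: in_totatives_iff)
  \<comment> \<open>The totatives of \<open>q\<close> lie in \<open>1..q\<close> rather than
    \<open>0..q - 1\<close>, hence the shift before dividing by \<open>q\<close>.\<close>
  have "q * t + (j - 1) = q * t' + (j' - 1)" using assms(1) j by linarith
  moreover have "(q * t + i) div q = t" if "i < q" for i t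
    using that by simp
  ultimately have "t = t'" using j by (metis Suc_diff_1 Suc_le_lessD add_diff_cancel_left' diff_Suc_1 lessI less_le_trans)
  with assms(1) show ?thesis by simp
qed

text \<open>Modulo \<open>q\<close> the form is just \<open>p ^ 2\<close>.\<close>

lemma coprime_norm_form:
  assumes "coprime p q"
  shows "coprime (int q) (int p ^ 2 - n * int q ^ 2)"
proof -
  have "int p ^ 2 - n * int q ^ 2 = - (n * int q) * int q + int p ^ 2"
    by (simp add: power2_eq_square)
  then have "gcd (int q) (int p ^ 2 - n * int q ^ 2) = gcd (int q) (int p ^ 2)"
    by (simp only: gcd_add_mult)
  moreover have "coprime (int q) (int p ^ 2)" using assms by (simp add: coprime_commute)
  ultimately show ?thesis by (simp add: coprime_iff_gcd_eq_1)
qed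

text \<open>
  The coprime pairs \<open>(p, q)\<close> with \<open>p \<ge> K q\<close> give \<open>x = p\<^sup>2 - n q\<^sup>2\<close> and \<open>r\<close> with
  \<open>q r \<equiv> - p (mod x)\<close>. Two such pairs with the same \<open>(x, r)\<close> satisfy \<open>x dvd q' p - q p'\<close>, and
  \<open>p \<ge> K q\<close> makes this difference smaller than \<open>x\<close>.
\<close>
lemma card_D_pairs_ge_quadratic:
  fixes n :: int
  assumes "n \<noteq> 0" and K: "K = nat \<bar>n\<bar> + 1"
    and N: "5 * ((K + 1) * Q) ^ 2 + nat (n ^ 2) + 5 * nat \<bar>n\<bar> \<le> N"
  shows "Q * (Q + 1) div 2 \<le> card (D_pairs n N)"
proof -
  have "K \<ge> 2" using assms by simp
  \<comment> \<open>For each \<open>q\<close>, the numbers \<open>p = q * t + j\<close> run through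
    the totatives in \<open>Q div q\<close> consecutive blocks above \<open>K * q\<close>. So the
    total is the totient sum above, and \<open>p\<close> stays below
    \<open>(K + 1) * Q\<close>.\<close>
  define W where "W = (SIGMA q:{1..Q}. totatives q \<times> {K..<K + Q div q})"
  define f where "f = (\<lambda>(q :: nat, j :: nat, t). (q * t + j, q))"
  define X where "X = (\<lambda>(p :: nat, q :: nat). int p ^ 2 - n * int q ^ 2)"
  have "inj_on f W"
    by (auto simp: inj_on_def f_def W_def dest!: totative_blocks_eq_iff)
  moreover have "card W = Q * (Q + 1) div 2"
    unfolding sum_totient_mult_div[symmetric] by (simp add: W_def card_cartesian_product totient_def)
  ultimately have card: "card (f ` W) = Q * (Q + 1) div 2" by (simp add: card_image)
  have fW: "coprime p q \<and> 0 < q \<and> K * q \<le> p \<and> p \<le> (K + 1) * Q" if "(p, q) \<in> f ` W" for p q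
  proof -
    obtain j t where q: "1 \<le> q" "q \<le> Q" and j: "j \<in> totatives q" and t: "K \<le> t" "t < K + Q div q"
      and p: "p = q * t + j" using \<open>(p, q) \<in> f ` W\<close> by (auto simp: f_def W_def)
    have "coprime p q" using j gcd_add_mult[of q t j]
      by (simp add: p in_totatives_iff coprime_iff_gcd_eq_1 gcd.commute mult.commute add.commute)
    moreover have "K * q \<le> p" using t by (simp add: p mult.commute trans_le_add1)
    moreover have "p \<le> q * (t + 1)" using j by (simp add: p in_totatives_iff)
    moreover have "q * (t + 1) \<le> q * (K + Q div q)" using t by (intro mult_left_mono) auto
    moreover have "q * (K + Q div q) \<le> K * Q + Q"
      using q by (simp add: add_mult_distrib2 add_mono mult.commute[of q] div_times_less_eq_dividend)
    ultimately show ?thesis using q by simp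
  qed
  have X: "3 * int p ^ 2 \<le> 4 * X (p, q)" "4 * X (p, q) \<le> 5 * int p ^ 2" "0 < X (p, q)"
    if "(p, q) \<in> f ` W" for p q
  proof -
    \<comment> \<open>With \<open>K = \<bar>n\<bar> + 1\<close>, the difference is
      \<open>(\<bar>n\<bar> - 1) ^ 2\<close>. Then \<open>p \<ge> K * q\<close> gives
      \<open>\<bar>n\<bar> * q ^ 2 \<le> p ^ 2 / 4\<close>, so \<open>X (p, q)\<close> differs from
      \<open>p ^ 2\<close> by at most a quarter of it.\<close>
    have "4 * \<bar>n\<bar> \<le> int K ^ 2"
      using zero_le_power2[of "\<bar>n\<bar> - 1"] by (simp add: K power2_eq_square algebra_simps)
    then have "4 * \<bar>n\<bar> * int q ^ 2 \<le> int K ^ 2 * int q ^ 2" by (intro mult_right_mono) auto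
    also have "\<dots> = int (K * q) ^ 2" by (simp add: power_mult_distrib)
    also have "\<dots> \<le> int p ^ 2" using fW[OF that] by (intro power_mono) (auto simp del: of_nat_mult)
    finally have *: "4 * (\<bar>n\<bar> * int q ^ 2) \<le> int p ^ 2" by simp
    have "n * int q ^ 2 \<le> \<bar>n\<bar> * int q ^ 2" "- \<bar>n\<bar> * int q ^ 2 \<le> n * int q ^ 2"
      by (intro mult_right_mono; simp)+
    with * show 1: "3 * int p ^ 2 \<le> 4 * X (p, q)" and "4 * X (p, q) \<le> 5 * int p ^ 2"
      unfolding X_def by auto
    have "K * q > 0" using \<open>K \<ge> 2\<close> fW[OF that] by simp
    then have "p > 0" using fW[OF that] by linarith
    then have "int p ^ 2 > 0" by simp
    with 1 show "0 < X (p, q)" by linarith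
  qed
  have "\<exists>r. X (p, q) + \<bar>n\<bar> \<le> r \<and> r < 2 * X (p, q) + \<bar>n\<bar> \<and> X (p, q) dvd int q * r + int p"
    if pq: "(p, q) \<in> f ` W" for p q
  proof -
    have "coprime (int q) (X (p, q))"
      using coprime_norm_form fW[OF pq] by (simp add: X_def)
    then obtain s where "[int q * s = 1] (mod X (p, q))" using cong_solve_coprime_int by blast
    then have s: "X (p, q) dvd int q * s - 1" by (simp add: cong_iff_dvd_diff)
    \<comment> \<open>As \<open>s\<close> inverts \<open>q\<close>, the class of
      \<open>- p * s\<close> solves the required congruence.\<close>
    obtain r where r: "X (p, q) + \<bar>n\<bar> \<le> r" "r < X (p, q) + \<bar>n\<bar> + X (p, q)"
        "X (p, q) dvd r - (- int p * s)"
      using ex_cong_in_window[OF X(3)[OF pq]] .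
    have "int q * r + int p = int q * (r - (- int p * s)) - int p * (int q * s - 1)"
      by (simp add: algebra_simps)
    then have "X (p, q) dvd int q * r + int p" using r(3) s by (metis dvd_diff dvd_mult)
    with r show ?thesis by auto
  qed
  then have "\<forall>z \<in> f ` W. \<exists>r. X z + \<bar>n\<bar> \<le> r \<and> r < 2 * X z + \<bar>n\<bar> \<and> X z dvd int (snd z) * r + int (fst z)"
    by (metis prod.collapse)
  then obtain \<rho> where \<rho>: "\<forall>z \<in> f ` W. X z + \<bar>n\<bar> \<le> \<rho> z \<and> \<rho> z < 2 * X z + \<bar>n\<bar> \<and>
      X z dvd int (snd z) * \<rho> z + int (fst z)" using bchoice by metis
  define g where "g = (\<lambda>z. (X z, \<rho> z))"
  have "inj_on g (f ` W)"
  proof (rule inj_onI)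
    fix z z' assume z: "z \<in> f ` W" and z': "z' \<in> f ` W" and eq: "g z = g z'"
    obtain p q where pq: "z = (p, q)" by force
    obtain p' q' where pq': "z' = (p', q')" by force
    define x where "x = X z"
    define r where "r = \<rho> z"
    have "X z' = x" "\<rho> z' = r" using eq by (auto simp: g_def x_def r_def)
    then have "x dvd int q * r + int p" "x dvd int q' * r + int p'"
      using bspec[OF \<rho> z] bspec[OF \<rho> z']
      unfolding x_def[symmetric] r_def[symmetric] \<open>X z' = x\<close> \<open>\<rho> z' = r\<close> by (simp_all add: pq pq')
    then have "x dvd int q' * (int q * r + int p) - int q * (int q' * r + int p')" by simp
    also have "int q' * (int q * r + int p) - int q * (int q' * r + int p') = int (q' * p) - int (q * p')"
      by (simp add: algebra_simps)
    finally have dvd: "x dvd int (q' * p) - int (q * p')" .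
    have fz: "coprime p q" "0 < q" "K * q \<le> p" "coprime p' q'" "0 < q'" "K * q' \<le> p'"
      using fW[of p q] fW[of p' q'] z z' pq pq' by auto
    have x3: "3 * int p ^ 2 \<le> 4 * x" "3 * int p' ^ 2 \<le> 4 * x" "x > 0"
      using X[of p q] X[of p' q'] z z' pq pq' \<open>X z' = x\<close> by (auto simp: x_def)
    \<comment> \<open>The aim is that \<open>q' * p\<close> and \<open>q * p'\<close> differ by at
      most \<open>p * p' / 2 \<le> 2 * x / 3\<close>. The first bound uses
      \<open>2 * q \<le> p\<close> and \<open>2 * q' \<le> p'\<close>, the second combines
      \<open>3 * p ^ 2 \<le> 4 * x\<close> and its primed version by the arithmetic-geometric mean
      inequality.\<close>
    have "2 * int p * int p' \<le> int p ^ 2 + int p' ^ 2" 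
      using zero_le_power2[of "int p - int p'"] by (simp add: power2_eq_square algebra_simps)
    then have pp: "3 * int (p * p') \<le> 4 * x" using x3 by simp
    have "2 * q \<le> K * q" "2 * q' \<le> K * q'" using \<open>K \<ge> 2\<close> by (intro mult_right_mono; simp)+
    then have two: "2 * q' \<le> p'" "2 * q \<le> p" using fz by linarith+
    have "2 * q' * p \<le> p' * p" "2 * q * p' \<le> p * p'" using two by (intro mult_right_mono; simp)+
    then have "int (2 * q' * p) \<le> int (p' * p)" "int (2 * q * p') \<le> int (p * p')"
      by (simp_all only: of_nat_le_iff)
    then have "2 * int (q' * p) \<le> int (p * p')" "2 * int (q * p') \<le> int (p * p')"
      by (simp_all add: mult_ac)
    then have "\<bar>int (q' * p) - int (q * p')\<bar> < x" using pp x3(3) by linarith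
    then have "int (q' * p) - int (q * p') = 0" using dvd_imp_le_int[OF _ dvd] by fastforce
    then have "q' * p = q * p'" by (simp only: right_minus_eq of_nat_eq_iff)
    then have "p * q' = p' * q" by (simp only: mult.commute)
    moreover have "coprime p q" "coprime p' q'" using fz by simp_all
    ultimately have "p = p' \<and> q' = q"
      using coprime_crossproduct_nat[of p q p' q'] by (simp add: coprime_commute)
    then show "z = z'" by (simp add: pq pq')
  qed
  then have "Q * (Q + 1) div 2 = card (g ` f ` W)" using card by (simp add: card_image)
  also have "\<dots> \<le> card (D_pairs n N)"
  proof (rule card_D_pairs_ge[OF \<open>n \<noteq> 0\<close>])
    fix x r assume "(x, r) \<in> g ` f ` W"
    then obtain p q where pq: "(p, q) \<in> f ` W" and x: "x = X (p, q)" and r: "r = \<rho> (p, q)"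
      by (auto simp: g_def)
    have \<rho>': "x + \<bar>n\<bar> \<le> r" "r < 2 * x + \<bar>n\<bar>" "x dvd int q * r + int p"
      using bspec[OF \<rho> pq] by (simp_all add: x r)
    \<comment> \<open>This uses \<open>x = p ^ 2 - n * q ^ 2\<close>; afterwards
      \<open>q ^ 2\<close>, being coprime to \<open>x\<close>, cancels.\<close>
    have "int q ^ 2 * (r ^ 2 - n) = (int q * r - int p) * (int q * r + int p) + x"
      by (simp add: x X_def power2_eq_square algebra_simps)
    then have "x dvd int q ^ 2 * (r ^ 2 - n)" using \<rho>'(3) by simp
    moreover have "coprime x (int q ^ 2)"
      using coprime_norm_form[of p q n] fW[OF pq] by (simp add: x X_def coprime_commute)
    ultimately have "x dvd r ^ 2 - n" by (simp add: coprime_dvd_mult_right_iff)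
    moreover have "4 * x + n ^ 2 + 5 * \<bar>n\<bar> \<le> int N"
    proof -
      have "int p ^ 2 \<le> int ((K + 1) * Q) ^ 2" using fW[OF pq] by (intro power_mono) (auto simp del: of_nat_mult)
      moreover have "int (5 * ((K + 1) * Q) ^ 2 + nat (n ^ 2) + 5 * nat \<bar>n\<bar>) \<le> int N"
        using N by (simp only: of_nat_le_iff)
      moreover have "int (5 * ((K + 1) * Q) ^ 2 + nat (n ^ 2) + 5 * nat \<bar>n\<bar>)
          = 5 * int ((K + 1) * Q) ^ 2 + n ^ 2 + 5 * \<bar>n\<bar>" by simp
      ultimately show ?thesis using X(2)[OF pq] unfolding x by linarith
    qed
    ultimately show "0 < x \<and> x + \<bar>n\<bar> \<le> r \<and> r < 2 * x + \<bar>n\<bar> \<and> x dvd r ^ 2 - n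
               \<and> 4 * x + n ^ 2 + 5 * \<bar>n\<bar> \<le> int N"
      using \<rho>' X(3)[OF pq] x by simp
  qed
  finally show ?thesis .
qed

section \<open>Superlinear growth for square \<open>n\<close>\<close>

lemma totient_le_double: "totient d \<le> totient (2 * d)"
  by (simp add: totient_double)

text \<open>
  Coprime \<open>d\<close> and odd \<open>e\<close> give \<open>x = d e\<close> and \<open>r\<close> with \<open>r \<equiv> 1 (mod d)\<close>, \<open>r \<equiv> - 1 (mod e)\<close>. Since
  \<open>e\<close> is odd, no prime divides both \<open>r - 1\<close> and \<open>e\<close>, so \<open>d\<close> and \<open>e\<close> are determined by \<open>x\<close> and \<open>r\<close>.
\<close>
lemma card_D_pairs_1_ge:
  assumes "4 * X + 6 \<le> N"
  shows "(\<Sum>d = 1..D. totient d * (X div (2 * d ^ 2))) \<le> card (D_pairs 1 N)"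
proof -
  \<comment> \<open>Totatives of \<open>2 * d\<close> make \<open>e\<close> odd and coprime to
    \<open>d\<close> at once. As \<open>e \<le> 2 * d * (t + 1)\<close>, the range of
    \<open>t\<close> ensures \<open>d * e \<le> X\<close>.\<close>
  define W where "W = (SIGMA d:{1..D}. totatives (2 * d) \<times> {..<X div (2 * d ^ 2)})"
  define f where "f = (\<lambda>(d :: nat, j :: nat, t). (d, 2 * d * t + j))"
  have "inj_on f W"
    by (auto simp: inj_on_def f_def W_def dest!: totative_blocks_eq_iff)
  moreover have "card W = (\<Sum>d = 1..D. totient (2 * d) * (X div (2 * d ^ 2)))"
    by (simp add: W_def card_cartesian_product totient_def)
  ultimately have card: "card (f ` W) = (\<Sum>d = 1..D. totient (2 * d) * (X div (2 * d ^ 2)))"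
    by (simp add: card_image)
  have fW: "0 < d \<and> odd e \<and> coprime d e \<and> d * e \<le> X" if "(d, e) \<in> f ` W" for d e
  proof -
    obtain j t where d: "1 \<le> d" "d \<le> D" and j: "j \<in> totatives (2 * d)" and t: "t < X div (2 * d ^ 2)"
      and e: "e = 2 * d * t + j" using \<open>(d, e) \<in> f ` W\<close> by (auto simp: f_def W_def)
    have "coprime e (2 * d)" using j gcd_add_mult[of "2 * d" t j]
      by (simp add: e in_totatives_iff coprime_iff_gcd_eq_1 gcd.commute[of _ "2 * d"] mult.commute[of t] add.commute)
    then have "odd e" "coprime d e" by (auto simp: coprime_commute)
    moreover have "d * e \<le> d * (2 * d * t + 2 * d)" using j by (intro mult_left_mono) (auto simp: e in_totatives_iff)
    moreover have "d * (2 * d * t + 2 * d) = (t + 1) * (2 * d ^ 2)" by (simp add: power2_eq_square algebra_simps)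
    moreover have "(t + 1) * (2 * d ^ 2) \<le> (X div (2 * d ^ 2)) * (2 * d ^ 2)" using t by (intro mult_right_mono) auto
    moreover have "(X div (2 * d ^ 2)) * (2 * d ^ 2) \<le> X" by (rule div_times_less_eq_dividend)
    ultimately show ?thesis using d by linarith
  qed
  have "\<exists>r. int (d * e) + 1 \<le> r \<and> r < 2 * int (d * e) + 1 \<and> int d dvd r - 1 \<and> int e dvd r + 1"
    if "(d, e) \<in> f ` W" for d e
  proof -
    have "coprime (int d) (int e)" using fW[OF that] by simp
    then obtain r0 where "[r0 = 1] (mod int d)" "[r0 = - 1] (mod int e)"
      using binary_chinese_remainder_int by blast
    then have r0: "int d dvd r0 - 1" "int e dvd r0 + 1" by (simp_all add: cong_iff_dvd_diff)
    have "e > 0" using fW[OF that] by (auto intro: Nat.gr0I)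
    then have "int (d * e) > 0" using fW[OF that] by simp
    then obtain r where r: "int (d * e) + 1 \<le> r" "r < int (d * e) + 1 + int (d * e)" "int (d * e) dvd r - r0"
      using ex_cong_in_window by metis
    have "int d dvd r - r0" "int e dvd r - r0" using r(3) by (auto elim: dvd_mult_left dvd_mult_right)
    then have "int d dvd (r - r0) + (r0 - 1)" "int e dvd (r - r0) + (r0 + 1)" using r0 by (blast intro: dvd_add)+
    with r show ?thesis by auto
  qed
  then have "\<forall>z \<in> f ` W. \<exists>r. int (fst z * snd z) + 1 \<le> r \<and> r < 2 * int (fst z * snd z) + 1
      \<and> int (fst z) dvd r - 1 \<and> int (snd z) dvd r + 1"
    by (metis prod.collapse)
  then obtain \<rho> where \<rho>: "\<forall>z \<in> f ` W. int (fst z * snd z) + 1 \<le> \<rho> z \<and> \<rho> z < 2 * int (fst z * snd z) + 1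
      \<and> int (fst z) dvd \<rho> z - 1 \<and> int (snd z) dvd \<rho> z + 1" using bchoice by metis
  define g where "g = (\<lambda>z. (int (fst z * snd z), \<rho> z))"
  have "inj_on g (f ` W)"
  proof (rule inj_onI)
    fix z z' assume z: "z \<in> f ` W" and z': "z' \<in> f ` W" and eq: "g z = g z'"
    obtain d e where de: "z = (d, e)" by force
    obtain d' e' where de': "z' = (d', e')" by force
    have prod: "d * e = d' * e'" and r: "\<rho> z = \<rho> z'"
      using eq by (auto simp: g_def de de' simp flip: of_nat_mult)
    have dvds: "int d dvd \<rho> z - 1" "int e dvd \<rho> z + 1" "int d' dvd \<rho> z - 1" "int e' dvd \<rho> z + 1"
      using bspec[OF \<rho> z] bspec[OF \<rho> z'] r by (simp_all add: de de')
    have cop: "coprime a b" if "int a dvd \<rho> z - 1" "int b dvd \<rho> z + 1" "odd b" for a b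
    proof (rule coprimeI)
      fix c assume c: "c dvd a" "c dvd b"
      then have "int c dvd \<rho> z - 1" "int c dvd \<rho> z + 1" using that by (meson dvd_trans int_dvd_int_iff)+
      then have "int c dvd (\<rho> z + 1) - (\<rho> z - 1)" by (rule dvd_diff[rotated])
      then have "int c dvd int 2" by simp
      then have "c dvd 2" by (simp only: int_dvd_int_iff)
      then have "c = 1 \<or> c = 2" using two_is_prime_nat by (auto simp: prime_nat_iff)
      with c \<open>odd b\<close> show "is_unit c" by auto
    qed
    have "coprime d e'" "coprime d' e"
      using cop dvds fW[of d e] fW[of d' e'] z z' de de' by auto
    then have "d = d' \<and> e = e'" using prod
      by (subst (asm) coprime_crossproduct_nat) (auto simp: coprime_commute)
    then show "z = z'" by (simp add: de de')
  qed
  then have "card (f ` W) = card (g ` f ` W)" by (simp add: card_image)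
  also have "\<dots> \<le> card (D_pairs 1 N)"
  proof (rule card_D_pairs_ge)
    fix x r assume "(x, r) \<in> g ` f ` W"
    then obtain z where z: "z \<in> f ` W" "(x, r) = g z" by blast
    obtain d e where "z = (d, e)" by force
    with z have de: "(d, e) \<in> f ` W" and x: "x = int (d * e)" and r: "r = \<rho> (d, e)"
      by (auto simp: g_def)
    have \<rho>': "x + 1 \<le> r" "r < 2 * x + 1" "int d dvd r - 1" "int e dvd r + 1"
      using bspec[OF \<rho> de] by (simp_all add: x r)
    have "x dvd (r - 1) * (r + 1)" unfolding x of_nat_mult using \<rho>' by (intro mult_dvd_mono) auto
    then have "x dvd r ^ 2 - 1" by (simp add: power2_eq_square algebra_simps)
    \<comment> \<open>The constant \<open>6\<close> is \<open>n ^ 2 + 5 * \<bar>n\<bar>\<close> at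
      \<open>n = 1\<close>.\<close>
    moreover have "4 * x + 6 \<le> int N" using fW[OF de] assms by (simp add: x del: of_nat_mult)
    moreover have "x > 0" using \<rho>' by linarith
    ultimately show "0 < x \<and> x + \<bar>1\<bar> \<le> r \<and> r < 2 * x + \<bar>1\<bar> \<and> x dvd r ^ 2 - 1
               \<and> 4 * x + 1 ^ 2 + 5 * \<bar>1\<bar> \<le> int N"
      using \<rho>' by simp
  qed simp
  finally have "(\<Sum>d = 1..D. totient (2 * d) * (X div (2 * d ^ 2))) \<le> card (D_pairs 1 N)"
    by (simp add: card)
  moreover have "(\<Sum>d = 1..D. totient d * (X div (2 * d ^ 2))) \<le>
      (\<Sum>d = 1..D. totient (2 * d) * (X div (2 * d ^ 2)))"
    by (intro sum_mono mult_right_mono totient_le_double) auto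
  ultimately show ?thesis by linarith
qed

text \<open>Each block \<open>A < d \<le> 4 A\<close> contributes at least \<open>1/4\<close>.\<close>
lemma sum_totient_div_square_ge: "(\<Sum>d = 1..4 ^ i. real (totient d) / real d ^ 2) \<ge> real i / 4"
proof (induction i)
  case (Suc i)
  define A Q :: nat where "A = 4 ^ i" and "Q = 4 * A"
  have "A > 0" by (simp add: A_def)
  have split: "(\<Sum>d = 1..Q. h d) = (\<Sum>d = 1..A. h d) + (\<Sum>d = A + 1..Q. h d)" for h :: "nat \<Rightarrow> real"
    using sum.ub_add_nat[of 1 A h "3 * A"] by (simp add: Q_def)
  \<comment> \<open>The totient identity shows that the sum of \<open>totient q / q\<close> over
    \<open>q \<le> Q\<close> is at least \<open>Q / 2\<close>. Terms with
    \<open>q \<le> A = Q / 4\<close> contribute at most \<open>Q / 4\<close>, so the block keeps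
    \<open>Q / 4\<close>; finally \<open>1 / q \<le> Q / q ^ 2\<close>.\<close>
  have "real Q ^ 2 / 2 \<le> real (Q * (Q + 1) div 2)"
    by (simp add: real_of_nat_div power2_eq_square field_simps)
  also have "\<dots> = (\<Sum>q = 1..Q. real (totient q) * real (Q div q))"
    by (simp only: sum_totient_mult_div[symmetric] of_nat_sum of_nat_mult)
  also have "\<dots> \<le> (\<Sum>q = 1..Q. real (totient q) * (real Q / real q))"
    by (intro sum_mono mult_left_mono of_nat_div_le_of_nat) auto
  also have "\<dots> = real Q * (\<Sum>q = 1..Q. real (totient q) / real q)"
    by (simp add: sum_distrib_left mult_ac)
  finally have "real Q / 2 \<le> (\<Sum>q = 1..Q. real (totient q) / real q)"
    using \<open>A > 0\<close> by (simp add: power2_eq_square Q_def field_simps)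
  moreover have "(\<Sum>q = 1..A. real (totient q) / real q) \<le> (\<Sum>q = 1..A. 1)"
    by (intro sum_mono) (auto simp: divide_simps totient_le)
  ultimately have "real Q / 4 \<le> (\<Sum>q = A + 1..Q. real (totient q) / real q)"
    unfolding split by (simp add: Q_def)
  also have "\<dots> \<le> (\<Sum>q = A + 1..Q. real Q * (real (totient q) / real q ^ 2))"
    by (intro sum_mono) (auto simp: power2_eq_square divide_simps mult_right_mono)
  also have "\<dots> = real Q * (\<Sum>q = A + 1..Q. real (totient q) / real q ^ 2)"
    by (simp add: sum_distrib_left)
  finally have "1 / 4 \<le> (\<Sum>q = A + 1..Q. real (totient q) / real q ^ 2)"
    using \<open>A > 0\<close> by (simp add: Q_def field_simps)
  then have "real (Suc i) / 4 \<le> (\<Sum>d = 1..Q. real (totient d) / real d ^ 2)"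
    using Suc.IH unfolding split by (simp add: A_def)
  then show ?case by (simp add: Q_def A_def)
qed simp

text \<open>Fix \<open>D = 4 ^ i\<close>. Replacing the floors in \<open>card_D_pairs_1_ge\<close>
  by quotients loses at most \<open>D\<close> per term, so \<open>D ^ 2\<close> altogether, while
  the main term is \<open>X / 2\<close> times a sum that is at least \<open>i / 4\<close>, with
  \<open>i\<close> arbitrary.\<close>

lemma D_pairs_1_superlinear: "filterlim (\<lambda>N. real (card (D_pairs 1 N)) / real N) at_top at_top"
  unfolding filterlim_at_top_gt[where c = 0]
proof (intro allI impI)
  fix Z :: real assume "Z > 0"
  \<comment> \<open>Since \<open>X\<close> is about \<open>N / 4\<close>, the main term is about
    \<open>N * i / 32 \<ge> 2 * Z * N\<close>; one \<open>Z * N\<close> absorbs the constant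
    \<open>C\<close>.\<close>
  define i where "i = nat \<lceil>64 * Z\<rceil>"
  define D :: nat where "D = 4 ^ i"
  have i: "real i \<ge> 64 * Z" by (simp add: i_def real_nat_ceiling_ge)
  define C where "C = 3 * real i / 8 + real D ^ 2"
  show "\<forall>\<^sub>F N in at_top. Z \<le> real (card (D_pairs 1 N)) / real N"
    using eventually_ge_at_top[of "10 + nat \<lceil>C / Z\<rceil>"]
  proof eventually_elim
    case (elim N)
    then have N: "N \<ge> 10" "real N \<ge> C / Z" by linarith+
    define X where "X = (N - 6) div 4"
    have "4 * X + 6 \<le> N" using N by (simp add: X_def)
    have "N \<le> 4 * X + 12" using N by (simp add: X_def)
    then have X: "real N / 4 - 3 \<le> real X" by linarith
    have "real X / 2 * (real i / 4) - real D ^ 2 \<le>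
        real X / 2 * (\<Sum>d = 1..D. real (totient d) / real d ^ 2) - (\<Sum>d = 1..D. real D)"
      using sum_totient_div_square_ge[of i] by (intro diff_mono mult_left_mono) (auto simp: D_def power2_eq_square)
    also have "\<dots> = (\<Sum>d = 1..D. real (totient d) * (real X / (2 * real d ^ 2)) - real D)"
      by (simp only: sum_distrib_left sum_subtractf[symmetric]) (intro sum.cong; simp)
    also have "\<dots> \<le> (\<Sum>d = 1..D. real (totient d * (X div (2 * d ^ 2))))"
    proof (rule sum_mono)
      fix d assume d: "d \<in> {1..D}"
      have "real X / real (2 * d ^ 2) - real (X div (2 * d ^ 2)) \<le> 1"
        using real_of_int_div3[of "int X" "int (2 * d ^ 2)"] by (simp only: zdiv_int[symmetric] of_int_of_nat_eq)
      then have "real (totient d) * (real X / real (2 * d ^ 2) - real (X div (2 * d ^ 2))) \<le> real (totient d) * 1"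
        by (intro mult_left_mono) auto
      moreover have "real (totient d) \<le> real D" using totient_le[of d] d by simp
      ultimately show "real (totient d) * (real X / (2 * real d ^ 2)) - real D \<le>
          real (totient d * (X div (2 * d ^ 2)))" by (simp add: right_diff_distrib)
    qed
    also have "\<dots> \<le> real (card (D_pairs 1 N))"
      using card_D_pairs_1_ge[OF \<open>4 * X + 6 \<le> N\<close>, of D] by (simp flip: of_nat_sum of_nat_mult)
    finally have "real X * (real i / 8) - real D ^ 2 \<le> real (card (D_pairs 1 N))" by simp
    moreover have "(real N / 4 - 3) * (real i / 8) \<le> real X * (real i / 8)"
      using X by (intro mult_right_mono) auto
    moreover have "(real N / 4 - 3) * (real i / 8) - real D ^ 2 = real N * (real i / 32) - C"
      by (simp add: C_def algebra_simps)
    moreover have "real N * (2 * Z) \<le> real N * (real i / 32)" using i by (intro mult_left_mono) auto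
    moreover have "C \<le> real N * Z" using N \<open>Z > 0\<close> by (simp add: field_simps)
    ultimately have "real N * Z \<le> real (card (D_pairs 1 N))" by linarith
    then show ?case using N by (simp add: field_simps)
  qed
qed

text \<open>Multiplying both elements by \<open>k\<close> turns a D(1)-pair up to
  \<open>N div k\<close> into a D(k^2)-pair up to \<open>N\<close>. The factor
  \<open>1 / (2 * real k)\<close> comes from \<open>N \<le> 2 * k * (N div k)\<close> for
  \<open>N \<ge> k\<close>.\<close>

lemma D_pairs_square_superlinear:
  assumes "k > 0"
  shows "filterlim (\<lambda>N. real (card (D_pairs (int k ^ 2) N)) / real N) at_top at_top"
proof -
  have "filterlim (\<lambda>N. N div k) at_top at_top"
    unfolding filterlim_at_top
  proof (rule allI)
    fix Z show "\<forall>\<^sub>F N in at_top. Z \<le> N div k"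
      using eventually_ge_at_top[of "k * Z"]
      by eventually_elim (use assms in \<open>simp add: less_eq_div_iff_mult_less_eq mult.commute\<close>)
  qed
  then have "filterlim (\<lambda>N. real (card (D_pairs 1 (N div k))) / real (N div k)) at_top at_top"
    by (rule filterlim_compose[OF D_pairs_1_superlinear])
  then have "filterlim (\<lambda>N. real (card (D_pairs 1 (N div k))) / real (N div k) * (1 / (2 * real k))) at_top at_top"
    using assms by (subst mult.commute, intro filterlim_tendsto_pos_mult_at_top[OF tendsto_const]) auto
  then show ?thesis
  proof (rule filterlim_at_top_mono)
    show "\<forall>\<^sub>F N in at_top. real (card (D_pairs 1 (N div k))) / real (N div k) * (1 / (2 * real k))
        \<le> real (card (D_pairs (int k ^ 2) N)) / real N"
      using eventually_ge_at_top[of k]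
    proof eventually_elim
      case (elim N)
      have "card (D_pairs 1 (N div k)) \<le> card (D_pairs (int k ^ 2) N)"
      proof (rule card_inj_on_le[where f = "\<lambda>(x, y). (int k * x, int k * y)"])
        show "inj_on (\<lambda>(x, y). (int k * x, int k * y)) (D_pairs 1 (N div k))"
          using assms by (auto simp: inj_on_def)
        show "(\<lambda>(x, y). (int k * x, int k * y)) ` D_pairs 1 (N div k) \<subseteq> D_pairs (int k ^ 2) N"
        proof clarify
          fix x y assume "(x, y) \<in> D_pairs 1 (N div k)"
          then have xy: "0 < x" "x < y" "y \<le> int (N div k)" "is_square (x * y + 1)"
            by (auto simp: D_pairs_def)
          have "int k * y \<le> int k * int (N div k)" using xy by (intro mult_left_mono) auto
          also have "\<dots> \<le> int N" by (simp flip: of_nat_mult)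
          finally have "int k * y \<le> int N" .
          moreover have "int k * x * (int k * y) + int k ^ 2 = int k ^ 2 * (x * y + 1)"
            by (simp add: power2_eq_square algebra_simps)
          ultimately show "(int k * x, int k * y) \<in> D_pairs (int k ^ 2) N"
            using xy assms by (auto simp: D_pairs_def intro: is_nth_power_mult)
        qed
      qed (rule finite_D_pairs)
      moreover have "N div k > 0" using elim assms by (simp add: div_greater_zero_iff)
      moreover have "real N \<le> 2 * real k * real (N div k)"
      proof -
        have "N < k * (N div k) + k" using assms by (metis add_strict_left_mono mod_less_divisor mult_div_mod_eq)
        also have "\<dots> \<le> 2 * k * (N div k)" using \<open>N div k > 0\<close> by simp
        finally have "real N \<le> real (2 * k * (N div k))" by (simp only: of_nat_le_iff less_imp_le)
        then show ?thesis by simp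
      qed
      ultimately have "real (card (D_pairs 1 (N div k))) / (2 * real k * real (N div k))
          \<le> real (card (D_pairs (int k ^ 2) N)) / real N"
        using elim assms by (intro frac_le) auto
      then show ?case by (simp add: mult.commute)
    qed
  qed
qed

section \<open>A linear lower bound for every \<open>n\<close>\<close>

lemma D_pairs_linear_lower_bound:
  assumes "n \<noteq> 0"
  shows "\<exists>c>0. \<forall>\<^sub>F N in at_top. c * real N \<le> real (card (D_pairs n N))"
proof -
  define K where "K = nat \<bar>n\<bar> + 1"
  \<comment> \<open>For \<open>Q \<ge> 1\<close>, \<open>M * Q ^ 2\<close> dominates the size
    condition of \<open>card_D_pairs_ge_quadratic\<close>, so \<open>Q\<close> may be the floor of
    \<open>sqrt (N / M)\<close>.\<close>
  define M where "M = 5 * (K + 1) ^ 2 + nat (n ^ 2) + 5 * nat \<bar>n\<bar>"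
  have "M > 0" by (simp add: M_def)
  then have M: "real M > 0" by simp
  have "\<forall>\<^sub>F N in at_top. 1 / (8 * real M) * real N \<le> real (card (D_pairs n N))"
    using eventually_ge_at_top[of "4 * M"]
  proof eventually_elim
    case (elim N)
    define u where "u = sqrt (real N / real M)"
    define Q where "Q = nat \<lfloor>u\<rfloor>"
    have "sqrt (2 ^ 2) \<le> u" unfolding u_def using elim M by (intro real_sqrt_le_mono) (simp add: field_simps flip: of_nat_mult)
    then have u: "u \<ge> 2" by simp
    then have Q: "real Q \<le> u" "u < real Q + 1" by (auto simp: Q_def)
    have u2: "u ^ 2 = real N / real M" by (simp add: u_def)
    have "real Q ^ 2 \<le> u ^ 2" using Q by (intro power_mono) auto
    then have "real (M * Q ^ 2) \<le> real N" using M by (simp add: u2 field_simps)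
    then have MQ: "M * Q ^ 2 \<le> N" by (simp only: of_nat_le_iff)
    have "Q \<ge> 1" using u Q by linarith
    define A where "A = nat (n ^ 2) + 5 * nat \<bar>n\<bar>"
    have "M = 5 * (K + 1) ^ 2 + A" by (simp add: M_def A_def)
    then have "M * Q ^ 2 = 5 * ((K + 1) * Q) ^ 2 + A * Q ^ 2"
      unfolding power_mult_distrib by (simp only: add_mult_distrib mult.assoc)
    moreover have "A \<le> A * Q ^ 2" using \<open>Q \<ge> 1\<close> by simp
    ultimately have "5 * ((K + 1) * Q) ^ 2 + nat (n ^ 2) + 5 * nat \<bar>n\<bar> \<le> M * Q ^ 2"
      unfolding A_def by simp
    with MQ have "5 * ((K + 1) * Q) ^ 2 + nat (n ^ 2) + 5 * nat \<bar>n\<bar> \<le> N" by linarith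
    then have "Q * (Q + 1) div 2 \<le> card (D_pairs n N)"
      by (rule card_D_pairs_ge_quadratic[OF assms K_def])
    then have "real (Q * (Q + 1) div 2) \<le> real (card (D_pairs n N))" by (simp only: of_nat_le_iff)
    moreover have "real (Q * (Q + 1) div 2) = real Q * (real Q + 1) / 2"
      by (simp add: real_of_nat_div algebra_simps)
    \<comment> \<open>From \<open>u \<ge> 2\<close> follows
      \<open>Q > u - 1 \<ge> u / 2\<close>.\<close>
    moreover have "real Q * (real Q + 1) \<ge> (u / 2) * (u / 2)" using u Q by (intro mult_mono) auto
    ultimately have "u ^ 2 / 8 \<le> real (card (D_pairs n N))" by (simp add: power2_eq_square)
    then show ?case by (simp add: u2)
  qed
  then show ?thesis using M by (intro exI[of _ "1 / (8 * real M)"]) auto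
qed

section \<open>A divisor bound\<close>

lemma divisor_count_prime_power_mult:
  fixes p m :: nat
  assumes "prime p" "m > 0"
  shows "card {d. d dvd p ^ e * m} \<le> (e + 1) * card {d. d dvd m}"
proof -
  have "{d. d dvd p ^ e * m} \<subseteq> (\<lambda>(i, d). p ^ i * d) ` ({..e} \<times> {d. d dvd m})"
  proof
    fix d assume "d \<in> {d. d dvd p ^ e * m}"
    then obtain x y where "d = x * y" "x dvd p ^ e" "y dvd m" using dvd_productE by blast
    then show "d \<in> (\<lambda>(i, d). p ^ i * d) ` ({..e} \<times> {d. d dvd m})"
      using divides_primepow_nat[OF assms(1)] by force
  qed
  then have "card {d. d dvd p ^ e * m} \<le> card ((\<lambda>(i, d). p ^ i * d) ` ({..e} \<times> {d. d dvd m}))"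
    using assms by (intro card_mono) auto
  also have "\<dots> \<le> card ({..e} \<times> {d. d dvd m})" using assms by (intro card_image_le) auto
  finally show ?thesis by (simp add: card_cartesian_product)
qed

text \<open>Equality at \<open>e = 3\<close> dictates the constant \<open>8\<close>; from there on,
  the cube at most doubles when \<open>e\<close> grows by one.\<close>

lemma Suc_cube_le: "(e + 1) ^ 3 \<le> 8 * 2 ^ (e :: nat)" for e :: nat
proof (induction e rule: less_induct)
  case (less e)
  show ?case
  proof (cases "e \<le> 3")
    case True
    then have "e = 0 \<or> e = 1 \<or> e = 2 \<or> e = 3" by linarith
    then show ?thesis by (auto simp: power3_eq_cube)
  next
    case False
    define k where "k = e - 4"
    have k: "e = k + 4" using False by (simp add: k_def)
    have "(e + 1) ^ 3 \<le> 2 * (k + 4) ^ 3" by (simp add: k power3_eq_cube algebra_simps)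
    also have "(k + 4) ^ 3 = ((k + 3) + 1) ^ 3" by (simp add: algebra_simps)
    also have "\<dots> \<le> 8 * 2 ^ (k + 3)" using less.IH[of "k + 3"] k by simp
    finally show ?thesis by (simp add: k power_add)
  qed
qed

text \<open>The quotient of the cubed divisor count by \<open>m\<close> is multiplicative, with
  factor \<open>(k + 1) ^ 3 / p ^ k\<close> at \<open>p ^ k\<close>. This is at most
  \<open>8\<close> always, and at most \<open>1\<close> for \<open>p \<ge> 8\<close> because
  \<open>(k + 1) ^ 3 \<le> (2 ^ k) ^ 3 = 8 ^ k\<close>. The induction splits off the full power of
  one prime.\<close>

lemma divisor_count_cube_le:
  fixes m :: nat
  assumes "m > 0"
  shows "card {d. d dvd m} ^ 3 \<le> 8 ^ card {p. prime p \<and> p dvd m \<and> p < 8} * m"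
  using assms
proof (induction m rule: less_induct)
  case (less m)
  show ?case
  proof (cases "m = 1")
    case False
    then obtain p where p: "prime p" "p dvd m" using prime_factor_nat by blast
    obtain k m' where m': "\<not> p dvd m'" "m = m' * p ^ k"
      using prime_power_canonical[OF p(1) less.prems] by blast
    have "k > 0" using m' p by (cases k) auto
    have "m' > 0" using m' less.prems by (cases m') auto
    have "p \<ge> 2" using p(1) by (rule prime_ge_2_nat)
    have "1 < p ^ k" using \<open>k > 0\<close> \<open>p \<ge> 2\<close> by (intro one_less_power) auto
    then have "m' < m" using m' \<open>m' > 0\<close> by simp
    define small where "small = (\<lambda>m. {p. prime p \<and> p dvd m \<and> p < (8 :: nat)})"
    have fin: "finite (small x)" for x by (rule finite_subset[of _ "{..<8}"]) (auto simp: small_def)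
    have IH: "card {d. d dvd m'} ^ 3 \<le> 8 ^ card (small m') * m'"
      using less.IH[OF \<open>m' < m\<close> \<open>m' > 0\<close>] by (simp add: small_def)
    have "card {d. d dvd m} ^ 3 \<le> ((k + 1) * card {d. d dvd m'}) ^ 3"
      using divisor_count_prime_power_mult[OF p(1) \<open>m' > 0\<close>, of k] m'
      by (intro power_mono) (auto simp: mult.commute)
    also have "\<dots> = (k + 1) ^ 3 * card {d. d dvd m'} ^ 3" by (rule power_mult_distrib)
    also have "\<dots> \<le> (k + 1) ^ 3 * (8 ^ card (small m') * m')" using IH by (intro mult_left_mono) auto
    also have "\<dots> \<le> 8 ^ card (small m) * m"
    proof (cases "p < 8")
      case True
      have "insert p (small m') \<subseteq> small m" using p m' True by (auto simp: small_def)
      then have "card (insert p (small m')) \<le> card (small m)" by (intro card_mono fin)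
      moreover have "p \<notin> small m'" using m' by (simp add: small_def)
      ultimately have "Suc (card (small m')) \<le> card (small m)" using fin by simp
      then have "(8 :: nat) ^ Suc (card (small m')) \<le> 8 ^ card (small m)" by (intro power_increasing) auto
      then have "8 * 2 ^ k * (8 ^ card (small m') * m') \<le> 8 ^ card (small m) * (2 ^ k * m')" by simp
      also have "\<dots> \<le> 8 ^ card (small m) * (p ^ k * m')"
        using \<open>p \<ge> 2\<close> by (intro mult_left_mono mult_right_mono power_mono) auto
      finally have "8 * 2 ^ k * (8 ^ card (small m') * m') \<le> 8 ^ card (small m) * m" by (simp add: m' mult_ac)
      moreover have "(k + 1) ^ 3 * (8 ^ card (small m') * m') \<le> 8 * 2 ^ k * (8 ^ card (small m') * m')"
        by (intro mult_right_mono Suc_cube_le) auto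
      ultimately show ?thesis by linarith
    next
      case False
      have "k + 1 \<le> 2 ^ k" using less_exp[of k] by linarith
      then have "(k + 1) ^ 3 \<le> (2 ^ k) ^ 3" by (intro power_mono) auto
      also have "(2 ^ k) ^ 3 = (8 :: nat) ^ k" by (simp flip: power_mult add: mult.commute[of k] power_mult)
      also have "\<dots> \<le> p ^ k" using False by (intro power_mono) auto
      finally have "(k + 1) ^ 3 \<le> p ^ k" .
      moreover have "card (small m') \<le> card (small m)"
        using m' by (intro card_mono fin) (auto simp: small_def)
      then have "(8 :: nat) ^ card (small m') \<le> 8 ^ card (small m)" by (intro power_increasing) auto
      ultimately have "(k + 1) ^ 3 * (8 ^ card (small m') * m') \<le> p ^ k * (8 ^ card (small m) * m')"
        by (intro mult_mono) auto
      then show ?thesis by (simp add: m' mult_ac)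
    qed
    finally show ?thesis by (simp add: small_def)
  qed simp
qed

lemma divisor_count_le_powr:
  fixes m :: nat
  assumes "m > 0"
  shows "real (card {d. d dvd m}) \<le> 256 * real m powr (1 / 3)"
proof -
  \<comment> \<open>A crude count of the primes below \<open>8\<close> suffices, as
    \<open>8 ^ 8 = 256 ^ 3\<close>.\<close>
  have "card {p. prime p \<and> p dvd m \<and> p < 8} \<le> card {..<8 :: nat}" by (intro card_mono) auto
  then have "(8 :: nat) ^ card {p. prime p \<and> p dvd m \<and> p < 8} \<le> 8 ^ 8" by (intro power_increasing) auto
  then have "card {d. d dvd m} ^ 3 \<le> 8 ^ 8 * m"
    using divisor_count_cube_le[OF assms] mult_right_mono le_trans by blast
  then have "real (card {d. d dvd m}) ^ 3 \<le> real (8 ^ 8 * m)" by (simp only: of_nat_le_iff flip: of_nat_power)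
  also have "\<dots> = (256 * real m powr (1 / 3)) ^ 3"
  proof -
    have "(real m powr (1 / 3)) ^ 3 = real m"
      by (subst powr_realpow[symmetric]) (use assms in \<open>simp_all add: powr_powr\<close>)
    then show ?thesis by (simp add: power_mult_distrib)
  qed
  finally show ?thesis by (subst (asm) power_mono_iff) auto
qed

section \<open>Irregular triples\<close>

lemma quadratic_roots:
  fixes \<alpha> \<beta> \<gamma> :: int
  assumes "\<alpha> \<noteq> 0"
  shows "finite {c. \<alpha> * c ^ 2 + \<beta> * c + \<gamma> = 0}" "card {c. \<alpha> * c ^ 2 + \<beta> * c + \<gamma> = 0} \<le> 2"
proof -
  have p: "[:\<gamma>, \<beta>, \<alpha>:] \<noteq> 0" using assms by simp
  have eq: "{c. \<alpha> * c ^ 2 + \<beta> * c + \<gamma> = 0} = {c. poly [:\<gamma>, \<beta>, \<alpha>:] c = 0}"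
    by (simp add: power2_eq_square algebra_simps)
  show "finite {c. \<alpha> * c ^ 2 + \<beta> * c + \<gamma> = 0}" unfolding eq by (rule poly_roots_finite[OF p])
  have "card {c. poly [:\<gamma>, \<beta>, \<alpha>:] c = 0} \<le> degree [:\<gamma>, \<beta>, \<alpha>:]" using p by (rule card_poly_roots_bound)
  then show "card {c. \<alpha> * c ^ 2 + \<beta> * c + \<gamma> = 0} \<le> 2" unfolding eq using assms by simp
qed

text \<open>Small \<open>c\<close> are excluded so that the invariant \<open>e\<close> below is positive.\<close>
definition large_irr_triples :: "int \<Rightarrow> nat \<Rightarrow> (int \<times> int \<times> int) set" where
  "large_irr_triples n N = {(a, b, c) \<in> D_triples n N - reg_triples n N. 4 * \<bar>n\<bar> + n ^ 2 < c}"

lemma finite_large_irr_triples: "finite (large_irr_triples n N)"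
  by (rule finite_subset[OF _ finite_D_triples[of n N]]) (auto simp: large_irr_triples_def)

text \<open>
  Here \<open>e = n (a + b + c) + 2 a b c - 2 r s t\<close>, and the second factor of the product is its conjugate
  \<open>n (a + b + c) + 2 a b c + 2 r s t\<close>.
\<close>
lemma irr_triple_invariant:
  assumes "n \<noteq> 0" and irr: "(a, b, c) \<in> large_irr_triples n N"
  obtains e where "e \<ge> 1"
    "e * (2 * (n * (a + b + c) + 2 * a * b * c) - e) = n ^ 2 * ((c - a - b) ^ 2 - 4 * (a * b + n))"
    "2 * a * b * c + n * (a + b + c) \<le> 2 * (n * (a + b + c) + 2 * a * b * c) - e"
proof -
  have abc: "0 < a" "a < b" "b < c" "c \<le> int N" "4 * \<bar>n\<bar> + n ^ 2 < c"
    and sq: "is_square (a * b + n)" "is_square (a * c + n)" "is_square (b * c + n)"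
    and nreg: "(a, b, c) \<notin> reg_triples n N"
    using irr by (auto simp: large_irr_triples_def D_triples_def)
  obtain r s t where r: "r \<ge> 0" "a * b + n = r ^ 2" and s: "s \<ge> 0" "a * c + n = s ^ 2"
    and t: "t \<ge> 0" "b * c + n = t ^ 2"
    using sq unfolding is_square_int_iff by blast
  define e where "e = n * (a + b + c) + 2 * a * b * c - 2 * r * s * t"
  \<comment> \<open>With \<open>S = n * (a + b + c) + 2 * a * b * c\<close>, the product below is
    \<open>S ^ 2 - (2 * r * s * t) ^ 2\<close>, in which the roots occur only through their
    squares.\<close>
  have "4 * (a * b + n) * (a * c + n) * (b * c + n) = (2 * r * s * t) ^ 2"
    unfolding r s t by (simp add: power2_eq_square)
  then have prod: "e * (2 * (n * (a + b + c) + 2 * a * b * c) - e) = n ^ 2 * ((c - a - b) ^ 2 - 4 * (a * b + n))"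
    unfolding e_def by (simp add: power2_eq_square algebra_simps)
  \<comment> \<open>Once this is seen to be a square, \<open>c * e \<ge> - (n ^ 2) > - c\<close>
    gives \<open>e \<ge> 0\<close>.\<close>
  have "c * e + n ^ 2 = c * (n * (a + b + c) + 2 * a * b * c) + n ^ 2 - 2 * c * r * s * t"
    by (simp add: e_def algebra_simps)
  also have "\<dots> = c ^ 2 * (a * b + n) + (a * c + n) * (b * c + n) - 2 * c * r * s * t"
    by (simp add: power2_eq_square algebra_simps)
  also have "\<dots> = (c * r - s * t) ^ 2"
    unfolding r s t by (simp add: power2_eq_square algebra_simps)
  finally have "c * e + n ^ 2 \<ge> 0" by simp
  then have "c * (e + 1) > 0" using abc by (simp add: distrib_left)
  then have "e \<ge> 0" using abc by (simp add: zero_less_mult_iff)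
  moreover have "e \<noteq> 0"
  proof
    assume "e = 0"
    then have "(c - a - b) ^ 2 = (2 * r) ^ 2" using prod assms r by simp
    then consider "c - a - b = 2 * r" | "c - a - b = - (2 * r)" by (metis power2_eq_iff)
    then show False
    proof cases
      case 1
      then have "c = a + b + 2 * r" by simp
      then show False using nreg abc r unfolding reg_triples_def by auto
    next
      case 2
      \<comment> \<open>Here \<open>b < c\<close> gives \<open>2 * r < a\<close>. Then
        \<open>4 * (a * b + n) \<le> a * b\<close> bounds \<open>a * b\<close>, hence
        \<open>a + b\<close>, hence \<open>c \<le> a + b\<close>, contradicting the exclusion of
        small \<open>c\<close>.\<close>
      then have "(2 * r) ^ 2 \<le> a ^ 2" using r abc by (intro power_mono) auto
      then have "4 * (a * b) + 4 * n \<le> a * a" using r(2) by (simp add: power2_eq_square)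
      also have "a * a \<le> a * b" using abc by simp
      finally have "3 * (a * b) \<le> - (4 * n)" by simp
      moreover have "(a - 1) * (b - 1) \<ge> 0" using abc by simp
      then have "a * b \<ge> a + b - 1" by (simp add: algebra_simps)
      then have "3 * (a + b - 1) \<le> 3 * (a * b)" by (rule mult_left_mono) simp
      ultimately have "3 * (a + b - 1) \<le> - (4 * n)" by (metis order_trans)
      then have "3 * (a + b - 1) \<le> 4 * \<bar>n\<bar>" by linarith
      moreover have "c \<le> a + b" using 2 r by linarith
      moreover have "n ^ 2 > 0" using assms by simp
      ultimately show False using abc by (smt (verit))
    qed
  qed
  ultimately have "e \<ge> 1" by linarith
  \<comment> \<open>The two sides of the remaining inequality differ by exactly
    \<open>2 * r * s * t\<close>.\<close>
  moreover have "r * s * t \<ge> 0" using r s t by simp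
  then have "2 * a * b * c + n * (a + b + c) \<le> 2 * (n * (a + b + c) + 2 * a * b * c) - e"
    unfolding e_def by (simp add: algebra_simps)
  ultimately show ?thesis using prod that by blast
qed

text \<open>Expanded in \<open>c\<close>, the product identity is a quadratic equation with leading
  coefficient \<open>n ^ 2\<close>, so each \<open>e\<close> admits at most two \<open>c\<close>. If
  \<open>a * b \<ge> 3 * \<bar>n\<bar>\<close>, its second factor is at least
  \<open>a * b * c\<close> and its right side at most \<open>n ^ 2 * c ^ 2\<close>, so
  \<open>e \<le> n ^ 2 * N / (a * b)\<close>. For smaller \<open>a * b\<close> the trivial bound
  \<open>N\<close> is enough; this accounts for the summand
  \<open>3 * \<bar>n\<bar>\<close>.\<close>

lemma card_irr_extensions:
  assumes "n \<noteq> 0" "0 < a" "a < b"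
  shows "real (card {c. (a, b, c) \<in> large_irr_triples n N}) * real_of_int (a * b)
           \<le> real_of_int (2 * n ^ 2 + 3 * \<bar>n\<bar>) * real N"
proof -
  let ?C = "{c. (a, b, c) \<in> large_irr_triples n N}"
  have ab: "a * b > 0" using assms by simp
  show ?thesis
  proof (cases "a * b \<ge> 3 * \<bar>n\<bar>")
    case True
    define E where "E = n ^ 2 * int N div (a * b)"
    define R where "R = (\<lambda>e. {c. n ^ 2 * c ^ 2 + (- 2 * n ^ 2 * (a + b) - e * (2 * n + 4 * a * b)) * c +
        (n ^ 2 * ((a + b) ^ 2 - 4 * (a * b + n)) - e * (2 * n * (a + b) - e)) = 0})"
    have R: "finite (R e)" "card (R e) \<le> 2" for e
      unfolding R_def using assms by (intro quadratic_roots; simp)+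
    have sub: "?C \<subseteq> (\<Union>e\<in>{1..E}. R e)"
    proof
      fix c assume "c \<in> ?C"
      then have c: "(a, b, c) \<in> large_irr_triples n N" by simp
      then have abc: "b < c" "c \<le> int N" by (auto simp: large_irr_triples_def D_triples_def)
      obtain e where e: "e \<ge> 1"
        "e * (2 * (n * (a + b + c) + 2 * a * b * c) - e) = n ^ 2 * ((c - a - b) ^ 2 - 4 * (a * b + n))"
        "2 * a * b * c + n * (a + b + c) \<le> 2 * (n * (a + b + c) + 2 * a * b * c) - e"
        using irr_triple_invariant[OF assms(1) c] .
      have "c \<in> R e" using e(2) by (simp add: R_def power2_eq_square algebra_simps)
      have "\<bar>n\<bar> * (a + b + c) \<le> \<bar>n\<bar> * (3 * c)" using abc assms by (intro mult_left_mono) auto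
      moreover have "(3 * \<bar>n\<bar>) * c \<le> (a * b) * c" using True abc assms by (intro mult_right_mono) auto
      moreover have "- (\<bar>n\<bar> * (a + b + c)) \<le> n * (a + b + c)"
        using abc assms mult_right_mono[of "- \<bar>n\<bar>" n "a + b + c"] by simp
      ultimately have "a * b * c \<le> 2 * a * b * c + n * (a + b + c)" by (simp add: mult.assoc)
      then have "e * (a * b * c) \<le> e * (2 * (n * (a + b + c) + 2 * a * b * c) - e)"
        using e by (intro mult_left_mono) linarith+
      also have "\<dots> \<le> n ^ 2 * c ^ 2"
      proof -
        \<comment> \<open>Both \<open>a\<close> and \<open>b\<close> lie between \<open>0\<close>
          and \<open>c\<close>.\<close>
        have "\<bar>c - a - b\<bar> ^ 2 \<le> c ^ 2" using abc assms by (intro power_mono) auto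
        moreover have "a * b + n \<ge> 0"
          using True by linarith
        ultimately show ?thesis unfolding e(2) by (intro mult_left_mono) auto
      qed
      finally have "c * (e * (a * b)) \<le> c * (n ^ 2 * c)" by (simp add: power2_eq_square mult_ac)
      then have "e * (a * b) \<le> n ^ 2 * c" using abc assms by simp
      also have "\<dots> \<le> n ^ 2 * int N" using abc by (intro mult_left_mono) auto
      finally have "e * (a * b) div (a * b) \<le> E" unfolding E_def using ab by (rule zdiv_mono1)
      moreover have "e * (a * b) div (a * b) = e" using ab by (intro nonzero_mult_div_cancel_right) linarith
      ultimately have "e \<le> E" by linarith
      with e \<open>c \<in> R e\<close> show "c \<in> (\<Union>e\<in>{1..E}. R e)" by auto
    qed
    then have "card ?C \<le> card (\<Union>e\<in>{1..E}. R e)" using R by (intro card_mono) auto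
    also have "\<dots> \<le> (\<Sum>e\<in>{1..E}. card (R e))" by (rule card_UN_le) simp
    also have "\<dots> \<le> (\<Sum>e\<in>{1..E}. 2)" using R by (intro sum_mono)
    also have "\<dots> = 2 * nat E" by simp
    finally have "int (card ?C) \<le> 2 * int (nat E)" by linarith
    moreover have "E \<ge> 0" unfolding E_def using ab by (simp add: pos_imp_zdiv_nonneg_iff)
    ultimately have "int (card ?C) \<le> 2 * E" by simp
    then have "int (card ?C) * (a * b) \<le> 2 * E * (a * b)" using ab by (intro mult_right_mono) auto
    also have "E * (a * b) \<le> n ^ 2 * int N"
      unfolding E_def using ab by (metis mult.commute mult_div_mod_eq pos_mod_sign le_add_same_cancel1)
    then have "2 * E * (a * b) \<le> 2 * (n ^ 2 * int N)" by simp
    also have "\<dots> \<le> (2 * n ^ 2 + 3 * \<bar>n\<bar>) * int N" by (simp add: distrib_right)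
    finally have "real_of_int (int (card ?C) * (a * b)) \<le> real_of_int ((2 * n ^ 2 + 3 * \<bar>n\<bar>) * int N)"
      by (simp only: of_int_le_iff)
    then show ?thesis by simp
  next
    case False
    have "?C \<subseteq> {1..int N}" using assms by (auto simp: large_irr_triples_def D_triples_def)
    then have "card ?C \<le> card {1..int N}" by (intro card_mono) auto
    then have "real (card ?C) \<le> real N" by simp
    moreover have "a * b \<le> 2 * n ^ 2 + 3 * \<bar>n\<bar>" using False zero_le_power2[of n] by linarith
    then have "real_of_int (a * b) \<le> real_of_int (2 * n ^ 2 + 3 * \<bar>n\<bar>)" by (simp only: of_int_le_iff)
    moreover have "0 \<le> real_of_int (a * b)" using ab by (simp only: of_int_0_le_iff less_imp_le)
    ultimately have "real (card ?C) * real_of_int (a * b) \<le> real N * real_of_int (2 * n ^ 2 + 3 * \<bar>n\<bar>)"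
      by (intro mult_mono) auto
    then show ?thesis by (simp add: mult.commute)
  qed
qed

text \<open>The root \<open>t\<close> of \<open>b * c + n\<close> determines \<open>c\<close>. For
  fixed \<open>a\<close> and \<open>b\<close> this bound is o(N), unlike the one of order
  \<open>N / (a * b)\<close>.\<close>

lemma card_irr_extensions_sqrt:
  assumes "n \<noteq> 0" "0 < a" "a < b"
  shows "real (card {c. (a, b, c) \<in> large_irr_triples n N}) \<le> sqrt (real_of_int b * real N + \<bar>n\<bar>) + 1"
proof -
  let ?C = "{c. (a, b, c) \<in> large_irr_triples n N}"
  let ?T = "\<lfloor>sqrt (real_of_int b * real N + \<bar>n\<bar>)\<rfloor>"
  have "?C \<subseteq> (\<lambda>t. (t ^ 2 - n) div b) ` {0..?T}"
  proof
    fix c assume "c \<in> ?C"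
    then have "c \<le> int N" "is_square (b * c + n)" by (auto simp: large_irr_triples_def D_triples_def)
    then obtain t where t: "t \<ge> 0" "b * c + n = t ^ 2" by (auto simp: is_square_int_iff)
    have "b * c \<le> b * int N" using \<open>c \<le> int N\<close> assms by (intro mult_left_mono) auto
    then have "t ^ 2 \<le> b * int N + \<bar>n\<bar>" using t(2) by linarith
    then have "real_of_int (t ^ 2) \<le> real_of_int (b * int N + \<bar>n\<bar>)" by (simp only: of_int_le_iff)
    then have "real_of_int t \<le> sqrt (real_of_int b * real N + \<bar>n\<bar>)" by (intro real_le_rsqrt) simp
    then have "t \<in> {0..?T}" using t by (simp add: le_floor_iff)
    moreover have "c = (t ^ 2 - n) div b" using assms by (simp flip: t(2))
    ultimately show "c \<in> (\<lambda>t. (t ^ 2 - n) div b) ` {0..?T}" by blast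
  qed
  then have "card ?C \<le> card ((\<lambda>t. (t ^ 2 - n) div b) ` {0..?T})" by (intro card_mono) auto
  also have "\<dots> \<le> card {0..?T}" by (intro card_image_le) auto
  finally have "real (card ?C) \<le> real (nat (?T + 1))" by simp
  moreover have "sqrt (real_of_int b * real N + \<bar>n\<bar>) \<ge> 0" using assms by simp
  ultimately show ?thesis by linarith
qed

section \<open>Summation over the root \<open>r\<close> of \<open>a * b + n\<close>\<close>

definition irr_slice :: "int \<Rightarrow> nat \<Rightarrow> nat \<Rightarrow> (int \<times> int \<times> int) set" where
  "irr_slice n N r = {(a, b, c) \<in> large_irr_triples n N. a * b + n = int r ^ 2}"

lemma irr_slice_empty:
  assumes "int r ^ 2 \<le> n"
  shows "irr_slice n N r = {}"
proof -
  have False if "(a, b, c) \<in> irr_slice n N r" for a b c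
  proof -
    have "a > 0" "b > 0" "a * b + n = int r ^ 2"
      using that by (auto simp: irr_slice_def large_irr_triples_def D_triples_def)
    moreover from this have "a * b > 0" by simp
    ultimately show False using assms by linarith
  qed
  then show ?thesis by auto
qed

text \<open>In a slice \<open>a * b = r ^ 2 - n\<close> is fixed, so only a divisor \<open>a\<close>
  and an extension \<open>c\<close> remain to be chosen.\<close>

lemma card_irr_slice_le_sum:
  "card (irr_slice n N r) \<le>
     (\<Sum>a \<in> {a. 0 < a \<and> a dvd int r ^ 2 - n \<and> a < (int r ^ 2 - n) div a}.
        card {c. (a, (int r ^ 2 - n) div a, c) \<in> large_irr_triples n N})" (is "_ \<le> sum _ ?A")
proof (cases "int r ^ 2 \<le> n")
  case False
  define m where "m = int r ^ 2 - n"
  have "m > 0" using False by (simp add: m_def)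
  have "finite {a. a dvd m}" using \<open>m > 0\<close> by (intro finite_divisors_int) simp
  then have fin: "finite ?A" by (rule finite_subset[rotated]) (auto simp: m_def)
  have "irr_slice n N r \<subseteq> (\<Union>a\<in>?A. (\<lambda>c. (a, m div a, c)) ` {c. (a, m div a, c) \<in> large_irr_triples n N})"
  proof
    fix p assume p: "p \<in> irr_slice n N r"
    obtain a b c where abc: "p = (a, b, c)" by (cases p)
    have *: "(a, b, c) \<in> large_irr_triples n N" "0 < a" "a < b" and "m = a * b"
      using p abc by (auto simp: irr_slice_def large_irr_triples_def D_triples_def m_def)
    then have "m div a = b" "a dvd m" by auto
    with * show "p \<in> (\<Union>a\<in>?A. (\<lambda>c. (a, m div a, c)) ` {c. (a, m div a, c) \<in> large_irr_triples n N})"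
      by (auto simp: abc m_def)
  qed
  moreover have fC: "finite {c. (a, b, c) \<in> large_irr_triples n N}" for a b
    by (rule finite_subset[of _ "{0..int N}"]) (auto simp: large_irr_triples_def D_triples_def)
  ultimately have "card (irr_slice n N r) \<le>
      card (\<Union>a\<in>?A. (\<lambda>c. (a, m div a, c)) ` {c. (a, m div a, c) \<in> large_irr_triples n N})"
    using fin by (intro card_mono) auto
  also have "\<dots> \<le> (\<Sum>a\<in>?A. card ((\<lambda>c. (a, m div a, c)) ` {c. (a, m div a, c) \<in> large_irr_triples n N}))"
    using fin by (rule card_UN_le)
  also have "\<dots> \<le> (\<Sum>a\<in>?A. card {c. (a, m div a, c) \<in> large_irr_triples n N})"
    using fC by (intro sum_mono card_image_le)
  finally show ?thesis by (simp add: m_def)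
qed (simp add: irr_slice_empty)

text \<open>Put \<open>m = r ^ 2 - n\<close>. There are at most \<open>256 * m powr (1 / 3)\<close>
  choices of \<open>a\<close>, and each has O(N/m) extensions.\<close>

lemma card_irr_slice_bound:
  assumes "n \<noteq> 0" "n < int r ^ 2"
  shows "real (card (irr_slice n N r)) \<le> real_of_int (2 * n ^ 2 + 3 * \<bar>n\<bar>) * real N *
           (256 * real_of_int (int r ^ 2 - n) powr (- (2 / 3)))"
proof -
  define m where "m = int r ^ 2 - n"
  have m: "m > 0" using assms by (simp add: m_def)
  define K where "K = real_of_int (2 * n ^ 2 + 3 * \<bar>n\<bar>)"
  have K: "K \<ge> 0" unfolding K_def by (simp only: of_int_0_le_iff) simp
  let ?A = "{a. 0 < a \<and> a dvd m \<and> a < m div a}"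
  have sub: "?A \<subseteq> int ` {d. d dvd nat m}"
  proof
    fix a assume a: "a \<in> ?A"
    then have "nat a dvd nat m" using m by (simp add: nat_dvd_iff)
    with a show "a \<in> int ` {d. d dvd nat m}" by (intro image_eqI[of _ _ "nat a"]) auto
  qed
  have "card ?A \<le> card (int ` {d. d dvd nat m})" using sub m by (intro card_mono) auto
  also have "\<dots> \<le> card {d. d dvd nat m}" using m by (intro card_image_le) auto
  finally have "real (card ?A) \<le> real (card {d. d dvd nat m})" by simp
  also have "\<dots> \<le> 256 * real (nat m) powr (1 / 3)" using m by (intro divisor_count_le_powr) simp
  finally have cardA: "real (card ?A) \<le> 256 * real_of_int m powr (1 / 3)" using m by simp
  have "real (card (irr_slice n N r)) \<le> real (\<Sum>a\<in>?A. card {c. (a, m div a, c) \<in> large_irr_triples n N})"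
    using card_irr_slice_le_sum[of n N r] by (simp only: of_nat_le_iff m_def)
  also have "\<dots> = (\<Sum>a\<in>?A. real (card {c. (a, m div a, c) \<in> large_irr_triples n N}))" by simp
  also have "\<dots> \<le> (\<Sum>a\<in>?A. K * real N / real_of_int m)"
  proof (rule sum_mono)
    fix a assume a: "a \<in> ?A"
    then have "a * (m div a) = m" by simp
    then show "real (card {c. (a, m div a, c) \<in> large_irr_triples n N}) \<le> K * real N / real_of_int m"
      using card_irr_extensions[of n a "m div a" N] assms a m
      by (simp add: K_def pos_le_divide_eq del: of_int_mult of_int_add)
  qed
  also have "\<dots> = real (card ?A) * (K * real N / real_of_int m)" by simp
  also have "\<dots> \<le> (256 * real_of_int m powr (1 / 3)) * (K * real N / real_of_int m)"
    using cardA K m by (intro mult_right_mono) auto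
  also have "\<dots> = K * real N * (256 * (real_of_int m powr (1 / 3) / real_of_int m powr 1))"
    using m by simp
  also have "real_of_int m powr (1 / 3) / real_of_int m powr 1 = real_of_int m powr (- (2 / 3))"
    by (subst powr_diff[symmetric]) simp
  finally show ?thesis by (simp add: K_def m_def)
qed

lemma sqrt_over_linear_tendsto_0:
  assumes "b \<ge> 0" "d \<ge> 0"
  shows "(\<lambda>N. (sqrt (b * real N + d) + 1) / real N) \<longlonglongrightarrow> 0"
proof (rule tendsto_sandwich[OF _ _ tendsto_const])
  show "\<forall>\<^sub>F N in sequentially. 0 \<le> (sqrt (b * real N + d) + 1) / real N"
    using assms by (intro always_eventually allI divide_nonneg_nonneg add_nonneg_nonneg) auto
  show "\<forall>\<^sub>F N in sequentially. (sqrt (b * real N + d) + 1) / real N \<le> (sqrt (b + d) + 1) / sqrt (real N)"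
    using eventually_gt_at_top[of 0]
  proof eventually_elim
    case (elim N)
    have "d * 1 \<le> d * real N" using assms elim by (intro mult_left_mono) auto
    then have "sqrt (b * real N + d) \<le> sqrt ((b + d) * real N)"
      by (intro real_sqrt_le_mono) (simp add: distrib_right)
    then have "sqrt (b * real N + d) + 1 \<le> sqrt (b + d) * sqrt (real N) + 1 * sqrt (real N)"
      using elim by (intro add_mono) (auto simp: real_sqrt_mult)
    then have "(sqrt (b * real N + d) + 1) / real N \<le> (sqrt (b + d) + 1) * sqrt (real N) / real N"
      by (intro divide_right_mono) (auto simp: distrib_right)
    also have "\<dots> = (sqrt (b + d) + 1) / sqrt (real N)"
      using elim by (simp add: field_simps)
    finally show ?case .
  qed
  show "(\<lambda>N. (sqrt (b + d) + 1) / sqrt (real N)) \<longlonglongrightarrow> 0"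
    by (intro tendsto_divide_0[OF tendsto_const] filterlim_at_top_imp_at_infinity
        filterlim_compose[OF sqrt_at_top] filterlim_real_sequentially)
qed

text \<open>This is the termwise limit for Tannery's theorem: a finite sum over \<open>a\<close> of
  square-root bounds.\<close>

lemma card_irr_slice_tendsto_0:
  assumes "n \<noteq> 0"
  shows "(\<lambda>N. real (card (irr_slice n N r)) / real N) \<longlonglongrightarrow> 0"
proof -
  define m where "m = int r ^ 2 - n"
  let ?A = "{a. 0 < a \<and> a dvd m \<and> a < m div a}"
  let ?g = "\<lambda>a N. (sqrt (real_of_int (m div a) * real N + real_of_int \<bar>n\<bar>) + 1) / real N"
  have lim: "(\<lambda>N. \<Sum>a\<in>?A. ?g a N) \<longlonglongrightarrow> (\<Sum>a\<in>?A. 0)"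
    by (intro tendsto_sum sqrt_over_linear_tendsto_0) auto
  show ?thesis
  proof (rule tendsto_sandwich[OF _ _ tendsto_const])
    show "\<forall>\<^sub>F N in sequentially. 0 \<le> real (card (irr_slice n N r)) / real N" by simp
    show "\<forall>\<^sub>F N in sequentially. real (card (irr_slice n N r)) / real N \<le> (\<Sum>a\<in>?A. ?g a N)"
    proof (intro always_eventually allI)
      fix N
      have "real (card (irr_slice n N r)) \<le> real (\<Sum>a\<in>?A. card {c. (a, m div a, c) \<in> large_irr_triples n N})"
        using card_irr_slice_le_sum[of n N r] by (simp only: of_nat_le_iff m_def)
      also have "\<dots> = (\<Sum>a\<in>?A. real (card {c. (a, m div a, c) \<in> large_irr_triples n N}))" by simp
      also have "\<dots> \<le> (\<Sum>a\<in>?A. sqrt (real_of_int (m div a) * real N + real_of_int \<bar>n\<bar>) + 1)"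
        using assms by (intro sum_mono card_irr_extensions_sqrt) auto
      finally have "real (card (irr_slice n N r)) / real N \<le>
          (\<Sum>a\<in>?A. sqrt (real_of_int (m div a) * real N + real_of_int \<bar>n\<bar>) + 1) / real N"
        by (intro divide_right_mono) auto
      then show "real (card (irr_slice n N r)) / real N \<le> (\<Sum>a\<in>?A. ?g a N)"
        by (simp only: sum_divide_distrib)
    qed
    show "(\<lambda>N. \<Sum>a\<in>?A. ?g a N) \<longlonglongrightarrow> 0" using lim by simp
  qed
qed

text \<open>This is the majorant for Tannery's theorem, uniform in \<open>N\<close>. For large
  \<open>r\<close>, \<open>r ^ 2 - n \<ge> r ^ 2 / 2\<close>, and the exponent
  \<open>- 2 / 3\<close> doubles to \<open>- 4 / 3\<close>, which is summable.\<close>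

lemma card_irr_slice_dominated:
  assumes "n \<noteq> 0"
  shows "\<exists>C. \<forall>\<^sub>F r in sequentially. \<forall>N. real (card (irr_slice n N r)) / real N \<le> C * real r powr (- (4 / 3))"
proof -
  define K where "K = real_of_int (2 * n ^ 2 + 3 * \<bar>n\<bar>)"
  have K: "K \<ge> 0" unfolding K_def by (simp only: of_int_0_le_iff) simp
  have "\<forall>\<^sub>F r in sequentially. \<forall>N. real (card (irr_slice n N r)) / real N
      \<le> (K * 256 * (1 / 2) powr (- (2 / 3))) * real r powr (- (4 / 3))"
    using eventually_ge_at_top[of "2 * nat \<bar>n\<bar> + 1"]
  proof eventually_elim
    case (elim r)
    have r: "2 * \<bar>n\<bar> + 1 \<le> int r" using elim by linarith
    also have "int r * 1 \<le> int r * int r" using r by (intro mult_left_mono) auto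
    finally have r2: "2 * \<bar>n\<bar> < int r ^ 2" by (simp add: power2_eq_square)
    then have "n < int r ^ 2" by linarith
    have "int r ^ 2 \<le> 2 * (int r ^ 2 - n)"
      using r2 unfolding right_diff_distrib by linarith
    then have "real_of_int (int r ^ 2) \<le> real_of_int (2 * (int r ^ 2 - n))"
      by (simp only: of_int_le_iff)
    then have half: "1 / 2 * real r ^ 2 \<le> real_of_int (int r ^ 2 - n)" by simp
    have "real_of_int (int r ^ 2 - n) powr (- (2 / 3)) \<le> (1 / 2 * real r ^ 2) powr (- (2 / 3))"
      using half r by (intro powr_mono2') auto
    also have "\<dots> = (1 / 2) powr (- (2 / 3)) * (real r ^ 2) powr (- (2 / 3))"
      by (rule powr_mult)
    also have "(real r ^ 2) powr (- (2 / 3)) = real r powr (- (4 / 3))"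
    proof -
      have "real r ^ 2 = real r powr 2" using r by simp
      then show ?thesis by (simp only: powr_powr) simp
    qed
    finally have *: "real_of_int (int r ^ 2 - n) powr (- (2 / 3)) \<le> (1 / 2) powr (- (2 / 3)) * real r powr (- (4 / 3))" .
    show ?case
    proof
      fix N
      have "real (card (irr_slice n N r)) \<le> K * real N * (256 * real_of_int (int r ^ 2 - n) powr (- (2 / 3)))"
        using card_irr_slice_bound[OF assms \<open>n < int r ^ 2\<close>] by (simp add: K_def)
      also have "\<dots> \<le> K * real N * (256 * ((1 / 2) powr (- (2 / 3)) * real r powr (- (4 / 3))))"
        using * K by (intro mult_left_mono) auto
      finally have "real (card (irr_slice n N r)) \<le> real N * (K * 256 * (1 / 2) powr (- (2 / 3)) * real r powr (- (4 / 3)))"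
        by (simp add: mult_ac)
      then show "real (card (irr_slice n N r)) / real N
          \<le> (K * 256 * (1 / 2) powr (- (2 / 3))) * real r powr (- (4 / 3))"
        \<comment> \<open>At \<open>N = 0\<close> the quotient is \<open>0\<close> by
          convention.\<close>
        using K by (cases "N = 0") (auto simp: field_simps)
    qed
  qed
  then show ?thesis by blast
qed

lemma card_large_irr_triples_tendsto_0:
  assumes "n \<noteq> 0"
  shows "(\<lambda>N. real (card (large_irr_triples n N)) / real N) \<longlonglongrightarrow> 0"
proof -
  define F where "F = (\<lambda>r N. real (card (irr_slice n N r)) / real N)"
  obtain C where C: "\<forall>\<^sub>F r in sequentially. \<forall>N. F r N \<le> C * real r powr (- (4 / 3))"
    using card_irr_slice_dominated[OF assms] by (auto simp: F_def)
  have "\<forall>\<^sub>F (r, N) in sequentially \<times>\<^sub>F sequentially. norm (F r N) \<le> C * real r powr (- (4 / 3))"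
    unfolding case_prod_unfold
  proof (rule eventually_mono[OF eventually_compose_filterlim[OF C filterlim_fst]])
    fix x :: "nat \<times> nat"
    assume "\<forall>N. F (fst x) N \<le> C * real (fst x) powr (- (4 / 3))"
    then show "norm (F (fst x) (snd x)) \<le> C * real (fst x) powr (- (4 / 3))"
      by (simp add: F_def)
  qed
  moreover have "summable (\<lambda>r. C * real r powr (- (4 / 3)))"
    by (intro summable_mult) (simp add: summable_real_powr_iff)
  moreover have "\<And>r. (\<lambda>N. F r N) \<longlonglongrightarrow> 0"
    unfolding F_def by (rule card_irr_slice_tendsto_0[OF assms])
  ultimately have "(\<lambda>N. \<Sum>r. F r N) \<longlonglongrightarrow> (\<Sum>r :: nat. 0)"
    using tannerys_theorem[of F "\<lambda>_. 0" sequentially "\<lambda>r. C * real r powr (- (4 / 3))"] by simp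
  then have lim: "(\<lambda>N. \<Sum>r. F r N) \<longlonglongrightarrow> 0" by simp
  have le: "real (card (large_irr_triples n N)) / real N \<le> (\<Sum>r. F r N)" for N
  proof -
    \<comment> \<open>A root satisfies \<open>r ^ 2 \<le> N ^ 2 + \<bar>n\<bar> \<le> B ^ 2\<close>,
      so for each \<open>N\<close> the series over \<open>r\<close> is a finite sum.\<close>
    define B where "B = N + nat \<bar>n\<bar>"
    have root: "\<exists>r\<le>B. (a, b, c) \<in> irr_slice n N r" if "(a, b, c) \<in> large_irr_triples n N" for a b c
    proof -
      have abc: "0 < a" "a < b" "b < c" "c \<le> int N" and "is_square (a * b + n)"
        using that by (auto simp: large_irr_triples_def D_triples_def)
      then obtain r where r: "r \<ge> 0" "a * b + n = r ^ 2" by (auto simp: is_square_int_iff)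
      have "a * b \<le> int N * int N" using abc by (intro mult_mono) auto
      moreover have "\<bar>n\<bar> * 1 \<le> \<bar>n\<bar> * (2 * int N + \<bar>n\<bar>)"
        using abc by (intro mult_left_mono) auto
      ultimately have "r ^ 2 \<le> (int N + \<bar>n\<bar>) ^ 2"
        using r(2) abs_ge_self[of n] unfolding power2_eq_square by (simp add: algebra_simps)
      then have "r \<le> int N + \<bar>n\<bar>" by (rule power2_le_imp_le) simp
      then have "nat r \<le> B" by (simp add: B_def nat_le_iff)
      moreover have "(a, b, c) \<in> irr_slice n N (nat r)" using that r by (simp add: irr_slice_def)
      ultimately show ?thesis by blast
    qed
    have fin: "finite (irr_slice n N r)" for r
      by (rule finite_subset[OF _ finite_large_irr_triples[of n N]]) (auto simp: irr_slice_def)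
    have "large_irr_triples n N \<subseteq> (\<Union>r\<in>{..B}. irr_slice n N r)"
      using root by fastforce
    then have "card (large_irr_triples n N) \<le> card (\<Union>r\<in>{..B}. irr_slice n N r)"
      using fin by (intro card_mono) auto
    also have "\<dots> \<le> (\<Sum>r\<in>{..B}. card (irr_slice n N r))" by (rule card_UN_le) simp
    finally have "real (card (large_irr_triples n N)) \<le> real (\<Sum>r\<in>{..B}. card (irr_slice n N r))"
      by (simp only: of_nat_le_iff)
    then have "real (card (large_irr_triples n N)) / real N \<le> (\<Sum>r\<in>{..B}. F r N)"
      unfolding F_def sum_divide_distrib[symmetric] of_nat_sum[symmetric] by (rule divide_right_mono) simp
    also have "\<dots> = (\<Sum>r. F r N)"
    proof (rule suminf_finite[symmetric])
      fix r assume r: "r \<notin> {..B}"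
      have "irr_slice n N r = {}"
      proof (rule ccontr)
        assume "irr_slice n N r \<noteq> {}"
        then obtain a b c where abc: "(a, b, c) \<in> irr_slice n N r" by (metis ex_in_conv prod_cases3)
        then have "(a, b, c) \<in> large_irr_triples n N" by (simp add: irr_slice_def)
        then obtain r' where r': "r' \<le> B" "(a, b, c) \<in> irr_slice n N r'" using root by blast
        with abc have "int r ^ 2 = int r' ^ 2" by (auto simp: irr_slice_def)
        then have "r = r'" by (simp add: power2_eq_iff_nonneg)
        with r r' show False by simp
      qed
      then show "F r N = 0" by (simp add: F_def)
    qed simp
    finally show ?thesis .
  qed
  show ?thesis
    by (rule tendsto_sandwich[OF _ _ tendsto_const lim]) (use le in auto)
qed

section \<open>Error terms\<close>

lemma card_irr_triples_smallo:
  assumes "n \<noteq> 0"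
  shows "(\<lambda>N. real (card (D_triples n N - reg_triples n N))) \<in> o(\<lambda>N. real N)"
proof -
  define C0 where "C0 = 4 * \<bar>n\<bar> + n ^ 2"
  \<comment> \<open>All triples with small \<open>c\<close> lie in this box, whose size does not
    depend on \<open>N\<close>.\<close>
  define S where "S = {1..C0} \<times> {1..C0} \<times> {1..C0}"
  have "(\<lambda>N. real (card (large_irr_triples n N))) \<in> o(\<lambda>N. real N)"
  proof (rule smalloI_tendsto)
    show "\<forall>\<^sub>F N in sequentially. real N \<noteq> 0" using eventually_gt_at_top[of 0] by eventually_elim simp
  qed (rule card_large_irr_triples_tendsto_0[OF assms])
  moreover have "(\<lambda>N. real (card S)) \<in> o(\<lambda>N. real N)"
    by (rule smalloI_tendsto) (auto intro: lim_const_over_n eventually_mono[OF eventually_gt_at_top[of 0]])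
  ultimately have sum: "(\<lambda>N. real (card (large_irr_triples n N)) + real (card S)) \<in> o(\<lambda>N. real N)"
    by (rule sum_in_smallo)
  have "card (D_triples n N - reg_triples n N) \<le> card (large_irr_triples n N) + card S" for N
  proof -
    have "D_triples n N - reg_triples n N \<subseteq> large_irr_triples n N \<union> S"
      by (auto simp: large_irr_triples_def S_def C0_def D_triples_def)
    then have "card (D_triples n N - reg_triples n N) \<le> card (large_irr_triples n N \<union> S)"
      by (intro card_mono) (auto simp: S_def finite_large_irr_triples)
    also have "\<dots> \<le> card (large_irr_triples n N) + card S" by (rule card_Un_le)
    finally show ?thesis .
  qed
  then have "real (card (D_triples n N - reg_triples n N)) \<le> real (card (large_irr_triples n N)) + real (card S)" for N
    by (simp only: of_nat_le_iff flip: of_nat_add)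
  then have "(\<lambda>N. real (card (D_triples n N - reg_triples n N))) \<in>
      O(\<lambda>N. real (card (large_irr_triples n N)) + real (card S))"
    by (intro landau_o.big_mono always_eventually allI) simp
  from landau_o.big_small_trans[OF this sum] show ?thesis .
qed

lemma linear_bigo_card_D_pairs:
  assumes "n \<noteq> 0"
  shows "(\<lambda>N. real N) \<in> O(\<lambda>N. real (card (D_pairs n N)))"
proof -
  obtain c where c: "c > 0" "\<forall>\<^sub>F N in at_top. c * real N \<le> real (card (D_pairs n N))"
    using D_pairs_linear_lower_bound[OF assms] by blast
  show ?thesis
    by (rule bigoI[of _ "1 / c"]) (use c in \<open>auto elim!: eventually_mono simp: field_simps\<close>)
qed

text \<open>For nonsquare \<open>n\<close>, a bounded number is compared with a count of at least
  linear growth; for square \<open>n\<close>, O(N) is compared with superlinear growth.\<close>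

lemma card_bad_pairs_smallo:
  assumes "n \<noteq> 0"
  shows "(\<lambda>N. real (card (bad_pairs n N))) \<in> o(\<lambda>N. real (card (D_pairs n N)))"
proof (cases "is_square n")
  case False
  have "(\<lambda>N. real (card (bad_pairs n N))) \<in> O(\<lambda>_ :: nat. 1 :: real)"
  proof (rule bigoI[of _ "real (nat (4 * \<bar>n\<bar>) ^ 2)"])
    show "\<forall>\<^sub>F N in sequentially. norm (real (card (bad_pairs n N))) \<le> real (nat (4 * \<bar>n\<bar>) ^ 2) * norm (1 :: real)"
      using card_bad_pairs_le_nonsquare[OF assms False] by (simp flip: of_nat_power)
  qed
  also have "(\<lambda>_ :: nat. 1 :: real) \<in> o(\<lambda>N. real N)"
    by (rule smalloI_tendsto) (auto intro: lim_const_over_n eventually_mono[OF eventually_gt_at_top[of 0]])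
  also have "(\<lambda>N. real N) \<in> O(\<lambda>N. real (card (D_pairs n N)))"
    by (rule linear_bigo_card_D_pairs[OF assms])
  finally show ?thesis .
next
  case True
  then obtain k where k: "k \<ge> 0" "n = k ^ 2" by (auto simp: is_square_int_iff)
  then have "nat k > 0" and n: "n = int (nat k) ^ 2" using assms by (auto intro: Nat.gr0I)
  have "(\<lambda>N. real (card (bad_pairs n N))) \<in> O(\<lambda>N. real N)"
  proof (rule bigoI)
    show "\<forall>\<^sub>F N in sequentially. norm (real (card (bad_pairs n N)))
        \<le> real (nat (4 * \<bar>n\<bar>) ^ 2 + nat (2 * \<bar>n\<bar>)) * norm (real N)"
      using eventually_ge_at_top[of 1]
    proof eventually_elim
      case (elim N)
      have "nat (4 * \<bar>n\<bar>) ^ 2 * 1 \<le> nat (4 * \<bar>n\<bar>) ^ 2 * N" using elim by (intro mult_left_mono) auto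
      then have "card (bad_pairs n N) \<le> (nat (4 * \<bar>n\<bar>) ^ 2 + nat (2 * \<bar>n\<bar>)) * N"
        using card_bad_pairs_le[OF assms, of N] unfolding add_mult_distrib by linarith
      then have "real (card (bad_pairs n N)) \<le> real ((nat (4 * \<bar>n\<bar>) ^ 2 + nat (2 * \<bar>n\<bar>)) * N)"
        by (simp only: of_nat_le_iff)
      then show ?case by simp
    qed
  qed
  also have "(\<lambda>N. real N) \<in> o(\<lambda>N. real (card (D_pairs n N)))"
    unfolding smallomega_iff_smallo[symmetric] n
    by (intro smallomegaI_filterlim_at_infinity filterlim_at_top_imp_at_infinity
        D_pairs_square_superlinear \<open>nat k > 0\<close>)
  finally show ?thesis .
qed


section \<open>Asymptotics\<close>

theorem theorem22:
  fixes n :: int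
  assumes "n \<noteq> 0"
  shows "(\<lambda>N. real (D3_count n N)) \<sim>[at_top] (\<lambda>N. real (D3_reg_count n N)) \<and>
         (\<lambda>N. real (D3_reg_count n N)) \<sim>[at_top] (\<lambda>N. real (D2_count n N) / 2)"
proof -
  let ?D2 = "\<lambda>N. real (D2_count n N)"
  let ?R = "\<lambda>N. real (D3_reg_count n N)"
  have diff: "(\<lambda>N. ?R N - ?D2 N / 2) \<in> o(\<lambda>N. ?D2 N / 2)"
  proof -
    have "?R N - ?D2 N / 2 = - (1 / 2) * real (card (bad_pairs n N))" for N
      by (simp add: D3_reg_count_eq D2_count_eq card_D_pairs add_divide_distrib)
    then show ?thesis using card_bad_pairs_smallo[OF assms] by (simp add: D2_count_eq)
  qed
  then have reg: "?R \<sim>[at_top] (\<lambda>N. ?D2 N / 2)" by (rule smallo_imp_asymp_equiv)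
  have "(\<lambda>N. real (D3_count n N) - ?R N) \<in> o(\<lambda>N. real N)"
  proof -
    have "real (D3_count n N) - ?R N = real (card (D_triples n N - reg_triples n N))" for N
      using card_mono[OF finite_D_triples reg_triples_subset, of n N]
      by (simp add: D3_count_eq D3_reg_count_eq card_Diff_subset[OF finite_reg_triples reg_triples_subset])
    then show ?thesis using card_irr_triples_smallo[OF assms] by simp
  qed
  \<comment> \<open>The chain transfers o(N) to the regular count, through the pairs and the
    equivalence \<open>reg\<close>.\<close>
  also have "(\<lambda>N. real N) \<in> O(?D2)"
    using linear_bigo_card_D_pairs[OF assms] by (simp add: D2_count_eq)
  also have "?D2 \<in> O(\<lambda>N. ?D2 N / 2)" by simp
  also have "(\<lambda>N. ?D2 N / 2) \<in> O(?R)"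
    using asymp_equiv_imp_bigtheta[OF asymp_equiv_symI[OF reg]] by (rule bigthetaD1)
  finally have "(\<lambda>N. real (D3_count n N)) \<sim>[at_top] ?R" by (rule smallo_imp_asymp_equiv)
  with reg show ?thesis by blast
qed

end
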